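(* Let $S$ be a positive integer and let $\{\psi_{j,k}: j=-1,0,1,\dots,\ k\in I_j\}$ be a boundary-corrected $S$-regular orthonormal wavelet basis of $L^2([0,1])$ as described in the context. Let $0<\beta_1\le\beta_2<S$ and $0<R_1\le R_2<\infty$. Consider the model in which one observes $(Y_t)_{t\in[0,1]}$ with $$dY_t = 2\sqrt{f(t)}\,dt + n^{-1/2}dW_t,\qquad t\in[0,1],$$ where $W$ is a standard Brownian motion and $f:[0,1]\to[0,\infty)$ is unknown; $\mathbb{P}_f$ denotes the law of the data. Fix $\tau>2\sqrt2$, choose $J_n$ with $n/2\le 2^{J_n}\le n$, put $Y_{j,k}=\int_0^1\psi_{j,k}(t)\,dY_t$, $$\widehat h=\sum_{j=-1}^{J_n}\sum_{k\in I_j} Y_{j,k}\,\mathbf 1\big(|Y_{j,k}|>\tau\sqrt{\log n/n}\big)\psi_{j,k},\qquad \widehat f=\widehat h^{\,2}/4 .$$ Let $$\tilde r^P_{n,\beta}(u)=\Big(\frac{\log n}{n}\Big)^{\frac{\beta}{\beta+1}}\vee\Big(u\,\frac{\log n}{n}\Big)^{\frac{\beta}{2\beta+1}},\qquad u\ge0.$$ Then there is a constant $C=C(\beta_1,\beta_2,R_1,R_2)$ such that $$\inf_{\substack{\beta_1\le\beta\le\beta_2\\ R_1\le R\le R_2}}\ \inf_{f:\ \|f\|_{\mathcal H^\beta}\le R}\ \mathbb{P}_f\Big(\sup_{x\in[0,1]}\frac{|\widehat f(x)-f(x)|}{\tilde r^P_{n,\beta}(f(x))}\le C\Big)\ \ge\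 1-\frac{3n^{-(\tau^2/8-1)}}{\sqrt{2\log n}} .$$
   Context: For $\beta>0$, $\lfloor\beta\rfloor$ denotes the greatest integer strictly smaller than $\beta$. For $f:[0,1]\to\mathbb R$ with $f^{(\lfloor\beta\rfloor)}$ existing, $|f|_{C^\beta}=\sup_{x\ne y}|f^{(\lfloor\beta\rfloor)}(x)-f^{(\lfloor\beta\rfloor)}(y)|/|x-y|^{\beta-\lfloor\beta\rfloor}$ and $\|f\|_{C^\beta}=\|f\|_\infty+\|f^{(\lfloor\beta\rfloor)}\|_\infty+|f|_{C^\beta}$ (sup-norms on $[0,1]$). The seminorm $|f|_{\mathcal H^\beta}=\max_{1\le j<\beta}\big(\sup_{x\in[0,1]}|f^{(j)}(x)|^\beta/|f(x)|^{\beta-j}\big)^{1/j}$, with $0/0:=0$ and $|f|_{\mathcal H^\beta}=0$ if $\beta\le1$. $\|f\|_{\mathcal H^\beta}=\|f\|_{C^\beta}+|f|_{\mathcal H^\beta}$ and $\mathcal H^\beta=\{f\in C^\beta: f\ge0,\ \|f\|_{\mathcal H^\beta}<\infty\}$. Wavelets: $\phi,\psi$ are bounded, compactly supported $S$-regular scaling and wavelet functions; the dilated/translated functions whose support meets $[0,1]$ are boundary-corrected (Cohen–Daubechies–Vial) to form an orthonormal basis $\{\psi_{j,k}: j\ge -1, k\in I_j\}$ of $L^2([0,1])$, with $\psi_{-1,k}$ the scaling functions and $|I_j|\le c2^j$. $a\vee b=\max(a,b)$. *)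

theory Defs
  imports "HOL-Probability.Probability"
begin

(* floor convention of the paper: greatest integer strictly smaller than beta *)
definition lfloor :: "real \<Rightarrow> nat" where
  "lfloor \<beta> = nat (\<lceil>\<beta>\<rceil> - 1)"

(* D k plays the role of f^(k) on [0,1] (one-sided derivatives at the endpoints).
   H_ball beta R f  <->  f \<in> H^beta and ||f||_{H^beta} <= R, where the norm is
   ||f||_inf + ||f^(m)||_inf + |f|_{C^beta} + |f|_{H^beta}, m = lfloor beta;
   each sup is encoded by an upper bound a, b, c, d (sum of sups <= R iff such bounds exist). *)
definition H_ball :: "real \<Rightarrow> real \<Rightarrow> (real \<Rightarrow> real) \<Rightarrow> bool" where
  "H_ball \<beta> R f \<longleftrightarrow>
     (\<forall>x\<in>{0..1}. 0 \<le> f x) \<and>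
     (\<exists>D :: nat \<Rightarrow> real \<Rightarrow> real.
        (\<forall>x\<in>{0..1}. D 0 x = f x) \<and>
        (\<forall>k<lfloor \<beta>. \<forall>x\<in>{0..1}.
            (D k has_real_derivative D (Suc k) x) (at x within {0..1})) \<and>
        (\<exists>a b c d.
           (\<forall>x\<in>{0..1}. \<bar>f x\<bar> \<le> a) \<and>
           (\<forall>x\<in>{0..1}. \<bar>D (lfloor \<beta>) x\<bar> \<le> b) \<and>
           (\<forall>x\<in>{0..1}. \<forall>y\<in>{0..1}. x \<noteq> y \<longrightarrow>
               \<bar>D (lfloor \<beta>) x - D (lfloor \<beta>) y\<bar> \<le> c * \<bar>x - y\<bar> powr (\<beta> - real (lfloor \<beta>))) \<and>
           0 \<le> d \<and>
           (\<forall>j::nat. 1 \<le> j \<and> real j < \<beta> \<longrightarrow>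
              (\<forall>x\<in>{0..1}. \<bar>D j x\<bar> powr \<beta> \<le> d ^ j * \<bar>f x\<bar> powr (\<beta> - real j))) \<and>
           a + b + c + d \<le> R))"

definition wavelet_basis :: "nat \<Rightarrow> (int \<Rightarrow> int \<Rightarrow> real \<Rightarrow> real) \<Rightarrow> (int \<Rightarrow> int set) \<Rightarrow> bool" where
  "wavelet_basis S \<psi> I \<longleftrightarrow> (\<exists>c>0.
     (\<forall>j\<ge>-1. finite (I j) \<and> real (card (I j)) \<le> c * 2 powr (real_of_int j)) \<and>
     (\<forall>j\<ge>-1. \<forall>k\<in>I j.
        \<psi> j k \<in> borel_measurable borel \<and> continuous_on {0..1} (\<psi> j k) \<and>
        (\<forall>x\<in>{0..1}. \<bar>\<psi> j k x\<bar> \<le> c * 2 powr (real_of_int j / 2)) \<and>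
        (\<exists>a. \<forall>x\<in>{0..1}. \<psi> j k x \<noteq> 0 \<longrightarrow> \<bar>x - a\<bar> \<le> c * 2 powr (- real_of_int j))) \<and>
     (\<forall>j\<ge>-1. \<forall>x\<in>{0..1}. real (card {k\<in>I j. \<psi> j k x \<noteq> 0}) \<le> c) \<and>
     (\<forall>j\<ge>-1. \<forall>k\<in>I j. \<forall>j'\<ge>-1. \<forall>k'\<in>I j'.
        (LINT t:{0..1}|lborel. \<psi> j k t * \<psi> j' k' t) = (if j = j' \<and> k = k' then 1 else 0)) \<and>
     (\<forall>g. g \<in> borel_measurable borel \<longrightarrow> set_integrable lborel {0..1} (\<lambda>t. (g t)\<^sup>2) \<longrightarrow>
        (\<forall>j\<ge>-1. \<forall>k\<in>I j. (LINT t:{0..1}|lborel. \<psi> j k t * g t) = 0) \<longrightarrow>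
        (AE t in lborel. t \<in> {0..1} \<longrightarrow> g t = 0)) \<and>
     (\<forall>j\<ge>0. \<forall>k\<in>I j. \<forall>m<S. (LINT t:{0..1}|lborel. \<psi> j k t * t ^ m) = 0))"

(* Gaussian white noise on [0,1] (isonormal process on L^2[0,1]):
   W g = \<integral>_0^1 g(t) dW_t for a standard Brownian motion W. *)
definition isonormal :: "'a measure \<Rightarrow> ((real \<Rightarrow> real) \<Rightarrow> 'a \<Rightarrow> real) \<Rightarrow> bool" where
  "isonormal M W \<longleftrightarrow>
     (\<forall>g. g \<in> borel_measurable borel \<and> set_integrable lborel {0..1} (\<lambda>t. (g t)\<^sup>2) \<longrightarrow>
        W g \<in> borel_measurable M \<and>
        (let s = sqrt (LINT t:{0..1}|lborel. (g t)\<^sup>2) in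
           if 0 < s then distributed M lborel (W g) (\<lambda>x. ennreal (normal_density 0 s x))
           else (AE \<omega> in M. W g \<omega> = 0))) \<and>
     (\<forall>g h a b. g \<in> borel_measurable borel \<and> set_integrable lborel {0..1} (\<lambda>t. (g t)\<^sup>2) \<and>
        h \<in> borel_measurable borel \<and> set_integrable lborel {0..1} (\<lambda>t. (h t)\<^sup>2) \<longrightarrow>
        (AE \<omega> in M. W (\<lambda>t. a * g t + b * h t) \<omega> = a * W g \<omega> + b * W h \<omega>))"

(* Y_{j,k} = \<integral> psi_{j,k} dY  with  dY = 2 sqrt f dt + n^{-1/2} dW *)
definition Ycoef :: "((real \<Rightarrow> real) \<Rightarrow> 'a \<Rightarrow> real) \<Rightarrow> (int \<Rightarrow> int \<Rightarrow> real \<Rightarrow> real) \<Rightarrow> nat \<Rightarrow>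
    (real \<Rightarrow> real) \<Rightarrow> int \<Rightarrow> int \<Rightarrow> 'a \<Rightarrow> real" where
  "Ycoef W \<psi> n f j k \<omega> =
     2 * (LINT t:{0..1}|lborel. \<psi> j k t * sqrt (f t)) + W (\<psi> j k) \<omega> / sqrt (real n)"

definition hhat :: "((real \<Rightarrow> real) \<Rightarrow> 'a \<Rightarrow> real) \<Rightarrow> (int \<Rightarrow> int \<Rightarrow> real \<Rightarrow> real) \<Rightarrow> (int \<Rightarrow> int set) \<Rightarrow>
    real \<Rightarrow> nat \<Rightarrow> nat \<Rightarrow> (real \<Rightarrow> real) \<Rightarrow> 'a \<Rightarrow> real \<Rightarrow> real" where
  "hhat W \<psi> I \<tau> n J f \<omega> x =
     (\<Sum>j\<in>{-1..int J}. \<Sum>k\<in>I j.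
        Ycoef W \<psi> n f j k \<omega> *
        (if \<bar>Ycoef W \<psi> n f j k \<omega>\<bar> > \<tau> * sqrt (ln (real n) / real n) then 1 else 0) * \<psi> j k x)"

definition fhat :: "((real \<Rightarrow> real) \<Rightarrow> 'a \<Rightarrow> real) \<Rightarrow> (int \<Rightarrow> int \<Rightarrow> real \<Rightarrow> real) \<Rightarrow> (int \<Rightarrow> int set) \<Rightarrow>
    real \<Rightarrow> nat \<Rightarrow> nat \<Rightarrow> (real \<Rightarrow> real) \<Rightarrow> 'a \<Rightarrow> real \<Rightarrow> real" where
  "fhat W \<psi> I \<tau> n J f \<omega> x = (hhat W \<psi> I \<tau> n J f \<omega> x)\<^sup>2 / 4"

definition rtilde :: "nat \<Rightarrow> real \<Rightarrow> real \<Rightarrow> real" where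
  "rtilde n \<beta> u = max ((ln (real n) / real n) powr (\<beta> / (\<beta> + 1)))
                        ((u * (ln (real n) / real n)) powr (\<beta> / (2 * \<beta> + 1)))"

end

theory Submission
  imports Defs "HOL-Real_Asymp.Real_Asymp"
begin

text \<open>Write \<open>h = 2 * sqrt f\<close>. If the noise coefficients are all below a fraction of the threshold, every
  thresholded coefficient has error at most a constant times \<open>min \<delta> \<bar>\<theta>\<bar>\<close>, where \<open>\<delta> = sqrt (log n / n)\<close>
  and \<open>\<theta>\<close> is the true coefficient. Membership of \<open>f\<close> in the flat Hoelder ball gives, for every
  wavelet at scale \<open>s\<close> that does not vanish at \<open>x\<close>, the two bounds
  \<open>\<bar>\<theta>\<bar> \<le> K * s powr ((\<beta> + 1) / 2)\<close> and \<open>sqrt (f x) * \<bar>\<theta>\<bar> \<le> K * s powr (\<beta> + 1 / 2)\<close>. Summing the minimum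
  with \<open>\<delta>\<close> over all scales bounds the error \<open>E\<close> of the estimate of \<open>h x\<close> by the square root of the first
  branch of the rate, and \<open>sqrt (f x) * E\<close> by the second branch when \<open>f x\<close> is large. Finally
  the error for \<open>f x\<close> is at most \<open>sqrt (f x) * E + E\<^sup>2 / 4\<close>.\<close>

subsection \<open>Taylor expansion and polynomial square roots\<close>

text \<open>Flatness makes \<open>f\<close> scale invariant instead: with space rescaled by
  \<open>f x powr (1 / \<beta>)\<close> and values by \<open>f x\<close>, the Taylor coefficients at
  \<open>x\<close> are bounded uniformly, and a polynomial square root exists with uniform
  constants. Linearising the root costs a factor \<open>1 / sqrt (f x)\<close>, which is why the
  second coefficient bound carries the weight \<open>sqrt (f x)\<close>.

  The two bounds mirror the two branches. Unweighted, the coefficients of \<open>h\<close> behave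
  like those of a function of smoothness \<open>\<beta> / 2\<close> observed with noise \<delta>;
  this gives \<open>E\<close> of order \<open>\<delta> powr (\<beta> / (\<beta> + 1))\<close>, whose
  square is the first branch. Weighted, they behave like smoothness \<beta> with noise
  \<open>sqrt (f x) * \<delta>\<close>, and \<open>(sqrt (f x) * \<delta>) powr (2 * \<beta> / (2 *
  \<beta> + 1))\<close> is the second branch.

  For uniformity over \<beta> and \<open>R\<close>, polynomial degrees and exponents are raised to
  \<open>S\<close>, while geometric ratios are controlled through \<open>\<beta>1\<close>.\<close>

lemma Taylor_Hoelder_remainder:
  fixes D :: "nat \<Rightarrow> real \<Rightarrow> real"
  assumes "\<And>k x. k < m \<Longrightarrow> x \<in> {0..1} \<Longrightarrow> (D k has_real_derivative D (Suc k) x) (at x within {0..1})"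
    and "\<And>x y. x \<in> {0..1} \<Longrightarrow> y \<in> {0..1} \<Longrightarrow> \<bar>D m x - D m y\<bar> \<le> c * \<bar>x - y\<bar> powr \<alpha>"
    and "0 \<le> c" "0 \<le> \<alpha>" "x \<in> {0..1}" "t \<in> {0..1}"
  shows "\<bar>D 0 t - (\<Sum>i\<le>m. D i x / fact i * (t - x) ^ i)\<bar> \<le> c * \<bar>t - x\<bar> powr (\<alpha> + real m)"
  using assms
proof (induction m arbitrary: D t)
  case 0
  then show ?case using "0.prems"(2)[of t x] by simp
next
  case (Suc m)
  \<comment> \<open>Differentiating the remainder \<open>G\<close> gives the remainder
    \<open>G'\<close> of the shifted family \<open>D (Suc i)\<close>, to which the induction
    hypothesis applies. On the segment from \<open>x\<close> to \<open>t\<close> that bound is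
    largest at \<open>t\<close>, and the length of the segment supplies the missing power.\<close>
  define G where "G y = D 0 y - (\<Sum>i\<le>Suc m. D i x / fact i * (y - x) ^ i)" for y
  define G' where "G' y = D 1 y - (\<Sum>i\<le>m. D (Suc i) x / fact i * (y - x) ^ i)" for y
  have IH: "\<bar>G' y\<bar> \<le> c * \<bar>y - x\<bar> powr (\<alpha> + real m)" if "y \<in> {0..1}" for y
    using Suc.IH[of "\<lambda>i. D (Suc i)" y] Suc.prems that unfolding G'_def by simp
  have pd: "((\<lambda>y. \<Sum>i\<le>Suc m. D i x / fact i * (y - x) ^ i) has_real_derivative
          (\<Sum>i\<le>m. D (Suc i) x / fact i * (y - x) ^ i)) (at y within T)" for y T
  proof -
    have "((\<lambda>y. D 0 x + (\<Sum>i\<le>m. D (Suc i) x / fact (Suc i) * (y - x) ^ Suc i)) has_real_derivative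
          (\<Sum>i\<le>m. D (Suc i) x / fact i * (y - x) ^ i)) (at y within T)"
      by (rule derivative_eq_intros refl | simp)+
        (auto intro!: sum.cong simp: field_simps)
    then show ?thesis by (simp add: sum.atMost_Suc_shift del: sum.atMost_Suc)
  qed
  have der: "(G has_real_derivative G' y) (at y within T)" if "y \<in> {0..1}" "T \<subseteq> {0..1}" for y T
    unfolding G_def G'_def
    by (intro DERIV_diff pd) (use Suc.prems(1)[of 0 y] that in \<open>auto intro: DERIV_subset\<close>)
  let ?T = "closed_segment x t"
  have sub: "?T \<subseteq> {0..1}"
    using Suc.prems(5,6) by (auto simp: closed_segment_eq_real_ivl split: if_splits)
  have "norm (G t - G x) \<le> (c * \<bar>t - x\<bar> powr (\<alpha> + real m)) * norm (t - x)"
  proof (rule field_differentiable_bound[of ?T])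
    show "convex ?T" by simp
    fix y assume y: "y \<in> ?T"
    show "(G has_field_derivative G' y) (at y within ?T)" using der y sub by blast
    have "\<bar>y - x\<bar> \<le> \<bar>t - x\<bar>"
      using y by (auto simp: closed_segment_eq_real_ivl split: if_splits)
    then have "c * \<bar>y - x\<bar> powr (\<alpha> + real m) \<le> c * \<bar>t - x\<bar> powr (\<alpha> + real m)"
      using Suc.prems by (intro mult_left_mono powr_mono2) auto
    then show "norm (G' y) \<le> c * \<bar>t - x\<bar> powr (\<alpha> + real m)"
      using IH[of y] y sub by auto
  qed auto
  moreover have "G x = 0" unfolding G_def by (simp add: sum.atMost_Suc_shift del: sum.atMost_Suc)
  moreover have "\<bar>t - x\<bar> powr (\<alpha> + real m) * \<bar>t - x\<bar> = \<bar>t - x\<bar> powr (\<alpha> + real (Suc m))"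
    using powr_mult_base[of "\<bar>t - x\<bar>" "\<alpha> + real m"] by (simp add: mult.commute add_ac)
  ultimately show ?case unfolding G_def[symmetric] by (simp add: mult.assoc)
qed

text \<open>The coefficients of the square root of a power series with constant term 1 are determined
  recursively by \<open>2 p\<^sub>i = q\<^sub>i - \<Sum>\<^sub>0\<^sub><\<^sub>a\<^sub><\<^sub>i p\<^sub>a p\<^sub>i\<^sub>-\<^sub>a\<close>, hence bounded in terms of the coefficients \<open>q\<close>.\<close>

lemma formal_sqrt_coeffs:
  "\<exists>B\<ge>1. \<forall>q :: nat \<Rightarrow> real. q 0 = 1 \<longrightarrow> (\<forall>i\<le>m. \<bar>q i\<bar> \<le> K) \<longrightarrow>
     (\<exists>p. p 0 = 1 \<and> (\<forall>i\<le>m. (\<Sum>a\<le>i. p a * p (i - a)) = q i \<and> \<bar>p i\<bar> \<le> B) \<and> (\<forall>i>m. p i = 0))"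
proof (induction m)
  case 0
  show ?case
    by (rule exI[of _ 1]) (auto intro!: exI[of _ "\<lambda>i::nat. if i = 0 then 1 else 0"])
next
  case (Suc m)
  then obtain B where B: "B \<ge> 1" and ex: "\<And>q :: nat \<Rightarrow> real. q 0 = 1 \<Longrightarrow> (\<forall>i\<le>m. \<bar>q i\<bar> \<le> K) \<Longrightarrow>
     (\<exists>p. p 0 = 1 \<and> (\<forall>i\<le>m. (\<Sum>a\<le>i. p a * p (i - a)) = q i \<and> \<bar>p i\<bar> \<le> B) \<and> (\<forall>i>m. p i = 0))"
    by blast
  define B' where "B' = B + \<bar>K\<bar> + real m * B\<^sup>2"
  show ?case
  proof (intro exI[of _ B'] conjI allI impI)
    show "B' \<ge> 1" using B by (simp add: B'_def add_increasing2)
    fix q :: "nat \<Rightarrow> real" assume q: "q 0 = 1" "\<forall>i\<le>Suc m. \<bar>q i\<bar> \<le> K"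
    then obtain p where p: "p 0 = 1" "\<forall>i\<le>m. (\<Sum>a\<le>i. p a * p (i - a)) = q i \<and> \<bar>p i\<bar> \<le> B"
      "\<forall>i>m. p i = 0" using ex[of q] by auto
    define v where "v = (q (Suc m) - (\<Sum>a\<in>{1..m}. p a * p (Suc m - a))) / 2"
    define p' where "p' = p(Suc m := v)"
    have "\<bar>\<Sum>a\<in>{1..m}. p a * p (Suc m - a)\<bar> \<le> (\<Sum>a\<in>{1..m}. B\<^sup>2)"
    proof (rule order_trans[OF sum_abs sum_mono])
      fix a assume "a \<in> {1..m}"
      then have "\<bar>p a\<bar> \<le> B" "\<bar>p (Suc m - a)\<bar> \<le> B" using p(2) by auto
      then show "\<bar>p a * p (Suc m - a)\<bar> \<le> B\<^sup>2"
        by (simp add: abs_mult power2_eq_square mult_mono')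
    qed
    then have v: "\<bar>v\<bar> \<le> B'"
      using q(2)[rule_format, of "Suc m"] B unfolding v_def B'_def by auto
    have bb: "B \<le> B'" by (simp add: B'_def)
    have "(\<Sum>a\<le>i. p' a * p' (i - a)) = q i \<and> \<bar>p' i\<bar> \<le> B'" if i: "i \<le> Suc m" for i
    proof (cases "i = Suc m")
      case False
      then have "(\<Sum>a\<le>i. p' a * p' (i - a)) = (\<Sum>a\<le>i. p a * p (i - a))"
        using i by (intro sum.cong) (auto simp: p'_def)
      then show ?thesis using p(2) i False bb unfolding p'_def
        by (auto simp: le_Suc_eq intro: order_trans)
    next
      case True
      have "(\<Sum>a\<le>Suc m. p' a * p' (Suc m - a)) = 2 * v + (\<Sum>a\<in>{1..m}. p' a * p' (Suc m - a))"
      proof -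
        have "{..Suc m} = insert 0 (insert (Suc m) {1..m})" by auto
        then show ?thesis using p(1) by (simp add: p'_def)
      qed
      also have "(\<Sum>a\<in>{1..m}. p' a * p' (Suc m - a)) = (\<Sum>a\<in>{1..m}. p a * p (Suc m - a))"
        by (intro sum.cong) (auto simp: p'_def)
      finally have "(\<Sum>a\<le>Suc m. p' a * p' (Suc m - a)) = q (Suc m)"
        by (simp add: v_def diff_divide_distrib del: sum.atMost_Suc)
      then show ?thesis using True v by (simp add: p'_def del: sum.atMost_Suc)
    qed
    moreover have "p' 0 = 1" "\<forall>i>Suc m. p' i = 0" using p by (auto simp: p'_def)
    ultimately show "\<exists>p. p 0 = 1 \<and> (\<forall>i\<le>Suc m. (\<Sum>a\<le>i. p a * p (i - a)) = q i \<and> \<bar>p i\<bar> \<le> B') \<and>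
      (\<forall>i>Suc m. p i = 0)" by blast
  qed
qed

text \<open>The square of the truncated formal root agrees with \<open>q\<close> through degree
  \<open>m\<close>, so only degrees \<open>m + 1\<close> to \<open>2 * m\<close> are left over. The
  lower bound \<open>1 / 2\<close> is what later permits division by a sum of two roots. Both
  \<open>B\<close> and \<open>e\<close> depend on \<open>m\<close> and \<open>K\<close>
  alone.\<close>

lemma polynomial_sqrt_approx:
  fixes K :: real
  shows "\<exists>B>0. \<exists>e>0. e \<le> 1 \<and> (\<forall>q :: nat \<Rightarrow> real. q 0 = 1 \<longrightarrow> (\<forall>i\<le>m. \<bar>q i\<bar> \<le> K) \<longrightarrow>
     (\<exists>p. \<forall>s. \<bar>s\<bar> \<le> e \<longrightarrow> 1 / 2 \<le> (\<Sum>i\<le>m. p i * s ^ i) \<and>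
        \<bar>(\<Sum>i\<le>m. p i * s ^ i)\<^sup>2 - (\<Sum>i\<le>m. q i * s ^ i)\<bar> \<le> B * \<bar>s\<bar> ^ Suc m))"
proof -
  obtain B where B: "B \<ge> 1" and ex: "\<And>q :: nat \<Rightarrow> real. q 0 = 1 \<Longrightarrow> (\<forall>i\<le>m. \<bar>q i\<bar> \<le> K) \<Longrightarrow>
     (\<exists>p. p 0 = 1 \<and> (\<forall>i\<le>m. (\<Sum>a\<le>i. p a * p (i - a)) = q i \<and> \<bar>p i\<bar> \<le> B) \<and> (\<forall>i>m. p i = 0))"
    using formal_sqrt_coeffs[of m K] by blast
  \<comment> \<open>With this \<open>e\<close> the nonconstant terms contribute at most
    \<open>m * B * e \<le> 1 / 2\<close>. In \<open>B'\<close>, each leftover coefficient is a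
    convolution of at most \<open>2 * m + 1\<close> products; there are only \<open>m\<close> of
    them, and the factor \<open>m + 1\<close> keeps \<open>B'\<close> positive for
    \<open>m = 0\<close>.\<close>
  define e where "e = 1 / (2 * (1 + real m * B))"
  define B' where "B' = real (m + 1) * (real (2 * m + 1) * B\<^sup>2)"
  have e: "0 < e" "e \<le> 1" "real m * B * e \<le> 1 / 2" using B
    by (auto simp: e_def field_simps add_pos_nonneg)
  show ?thesis
  proof (rule exI[of _ B'], rule conjI, goal_cases)
    case 1
    show ?case using B by (simp add: B'_def)
  next
    case 2
    show ?case
    proof (rule exI[of _ e], intro conjI allI impI)
      fix q :: "nat \<Rightarrow> real" assume "q 0 = 1" "\<forall>i\<le>m. \<bar>q i\<bar> \<le> K"
      from ex[OF this] obtain p where p: "p 0 = 1"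
        "\<And>i. i \<le> m \<Longrightarrow> (\<Sum>a\<le>i. p a * p (i - a)) = q i" "\<And>i. i \<le> m \<Longrightarrow> \<bar>p i\<bar> \<le> B" "\<And>i. i > m \<Longrightarrow> p i = 0"
        by blast
      have pB: "\<bar>p i\<bar> \<le> B" for i using p(3,4)[of i] B by (cases "i \<le> m") auto
      have "1 / 2 \<le> (\<Sum>i\<le>m. p i * s ^ i) \<and>
          \<bar>(\<Sum>i\<le>m. p i * s ^ i)\<^sup>2 - (\<Sum>i\<le>m. q i * s ^ i)\<bar> \<le> B' * \<bar>s\<bar> ^ Suc m" if s: "\<bar>s\<bar> \<le> e" for s
      proof
        have s1: "\<bar>s\<bar> \<le> 1" using s e by simp
        have "(\<Sum>i\<le>m. p i * s ^ i) = 1 + (\<Sum>i\<in>{1..m}. p i * s ^ i)"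
        proof -
          have "{..m} = insert 0 {1..m}" by auto
          then show ?thesis using p(1) by simp
        qed
        moreover have "\<bar>\<Sum>i\<in>{1..m}. p i * s ^ i\<bar> \<le> (\<Sum>i\<in>{1..m}. B * e)"
        proof (rule order_trans[OF sum_abs sum_mono])
          fix i assume i: "i \<in> {1..m}"
          have "\<bar>s\<bar> ^ i \<le> \<bar>s\<bar> ^ 1" using i s1 by (intro power_decreasing) auto
          then have "\<bar>s ^ i\<bar> \<le> e" using s by (simp add: power_abs)
          then show "\<bar>p i * s ^ i\<bar> \<le> B * e" using pB[of i] by (simp add: abs_mult mult_mono')
        qed
        ultimately show "1 / 2 \<le> (\<Sum>i\<le>m. p i * s ^ i)" using e(3) by (simp add: mult.assoc)
        let ?c = "\<lambda>r. \<Sum>k\<le>r. p k * p (r - k)"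
        have "(\<Sum>i\<le>m. p i * s ^ i)\<^sup>2 = (\<Sum>r\<le>m + m. ?c r * s ^ r)"
          unfolding power2_eq_square by (rule polynomial_product) (use p(4) in auto)
        also have "{..m + m} = {..m} \<union> {Suc m..m + m}" by auto
        also have "(\<Sum>r\<in>{..m} \<union> {Suc m..m + m}. ?c r * s ^ r) = (\<Sum>r\<le>m. ?c r * s ^ r) + (\<Sum>r\<in>{Suc m..m + m}. ?c r * s ^ r)"
          by (intro sum.union_disjoint) auto
        also have "(\<Sum>r\<le>m. ?c r * s ^ r) = (\<Sum>i\<le>m. q i * s ^ i)"
          using p(2) by (intro sum.cong) auto
        finally have "\<bar>(\<Sum>i\<le>m. p i * s ^ i)\<^sup>2 - (\<Sum>i\<le>m. q i * s ^ i)\<bar> = \<bar>\<Sum>r\<in>{Suc m..m + m}. ?c r * s ^ r\<bar>"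
          by simp
        also have "\<dots> \<le> (\<Sum>r\<in>{Suc m..m + m}. (real (2 * m + 1) * B\<^sup>2) * \<bar>s\<bar> ^ Suc m)"
        proof (rule order_trans[OF sum_abs sum_mono])
          fix r assume r: "r \<in> {Suc m..m + m}"
          have "\<bar>?c r\<bar> \<le> (\<Sum>k\<le>r. B\<^sup>2)"
            by (rule order_trans[OF sum_abs sum_mono])
              (use pB in \<open>simp add: abs_mult power2_eq_square mult_mono'\<close>)
          also have "\<dots> \<le> real (2 * m + 1) * B\<^sup>2" using r by (simp add: mult_right_mono)
          finally have "\<bar>?c r\<bar> \<le> real (2 * m + 1) * B\<^sup>2" .
          moreover have "\<bar>s\<bar> ^ r \<le> \<bar>s\<bar> ^ Suc m" using r s1 by (intro power_decreasing) auto
          ultimately show "\<bar>?c r * s ^ r\<bar> \<le> (real (2 * m + 1) * B\<^sup>2) * \<bar>s\<bar> ^ Suc m"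
            unfolding abs_mult power_abs by (intro mult_mono) auto
        qed
        also have "\<dots> \<le> B' * \<bar>s\<bar> ^ Suc m"
          unfolding B'_def by (simp del: power_Suc add: mult_right_mono mult.assoc)
        finally show "\<bar>(\<Sum>i\<le>m. p i * s ^ i)\<^sup>2 - (\<Sum>i\<le>m. q i * s ^ i)\<bar> \<le> B' * \<bar>s\<bar> ^ Suc m" .
      qed
      then show "\<exists>p. \<forall>s. \<bar>s\<bar> \<le> e \<longrightarrow> 1 / 2 \<le> (\<Sum>i\<le>m. p i * s ^ i) \<and>
          \<bar>(\<Sum>i\<le>m. p i * s ^ i)\<^sup>2 - (\<Sum>i\<le>m. q i * s ^ i)\<bar> \<le> B' * \<bar>s\<bar> ^ Suc m" by blast
    qed (use e in auto)
  qed
qed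

subsection \<open>Local approximation of the square root of f\<close>

lemma lfloor_bounds:
  assumes "0 < \<beta>"
  shows "real (lfloor \<beta>) < \<beta>" "\<beta> \<le> real (lfloor \<beta>) + 1"
proof -
  have "1 \<le> \<lceil>\<beta>\<rceil>" using assms by simp
  then have "real (lfloor \<beta>) = of_int \<lceil>\<beta>\<rceil> - 1" unfolding lfloor_def by simp
  then show "real (lfloor \<beta>) < \<beta>" "\<beta> \<le> real (lfloor \<beta>) + 1" by linarith+
qed

text \<open>The separate bounds are nonnegative and sum to at most \<open>R\<close>, so all of them
  may be replaced by the common \<open>R'\<close>; this is what makes later constants independent of
  \<open>R\<close>.\<close>

lemma H_ballE:
  assumes "H_ball \<beta> R f" "R \<le> R'" "0 < \<beta>"
  obtains D where
    "\<And>k x. k < lfloor \<beta> \<Longrightarrow> x \<in> {0..1} \<Longrightarrow> (D k has_real_derivative D (Suc k) x) (at x within {0..1})"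
    "\<And>x y. x \<in> {0..1} \<Longrightarrow> y \<in> {0..1} \<Longrightarrow>
        \<bar>D (lfloor \<beta>) x - D (lfloor \<beta>) y\<bar> \<le> R' * \<bar>x - y\<bar> powr (\<beta> - real (lfloor \<beta>))"
    "\<And>j x. 1 \<le> j \<Longrightarrow> real j < \<beta> \<Longrightarrow> x \<in> {0..1} \<Longrightarrow>
        \<bar>D j x\<bar> powr \<beta> \<le> R' ^ j * f x powr (\<beta> - real j)"
    "\<And>x. x \<in> {0..1} \<Longrightarrow> D 0 x = f x" "\<And>x. x \<in> {0..1} \<Longrightarrow> 0 \<le> f x" "\<And>x. x \<in> {0..1} \<Longrightarrow> f x \<le> R'"
proof -
  let ?m = "lfloor \<beta>"
  from assms(1) obtain D a b c d where nn: "\<forall>x\<in>{0..1}. 0 \<le> f x" and D0: "\<forall>x\<in>{0..1}. D 0 x = f x"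
    and der: "\<forall>k<?m. \<forall>x\<in>{0..1}. (D k has_real_derivative D (Suc k) x) (at x within {0..1})"
    and a: "\<forall>x\<in>{0..1}. \<bar>f x\<bar> \<le> a" and b: "\<forall>x\<in>{0..1}. \<bar>D ?m x\<bar> \<le> b"
    and c: "\<forall>x\<in>{0..1}. \<forall>y\<in>{0..1}. x \<noteq> y \<longrightarrow> \<bar>D ?m x - D ?m y\<bar> \<le> c * \<bar>x - y\<bar> powr (\<beta> - real ?m)"
    and d: "0 \<le> d" "\<forall>j::nat. 1 \<le> j \<and> real j < \<beta> \<longrightarrow>
              (\<forall>x\<in>{0..1}. \<bar>D j x\<bar> powr \<beta> \<le> d ^ j * \<bar>f x\<bar> powr (\<beta> - real j))"
    and sum: "a + b + c + d \<le> R"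
    unfolding H_ball_def by blast
  \<comment> \<open>The signs of \<open>a\<close>, \<open>b\<close>, \<open>c\<close> are read off
    at concrete points; for \<open>c\<close> the points 0 and 1 have distance 1, whose power is
    1.\<close>
  have "0 \<le> a" using a[rule_format, of 0] by simp
  moreover have "0 \<le> b" using b[rule_format, of 0] by simp
  moreover have "0 \<le> c" using c[rule_format, of 0 1] by simp
  ultimately have le: "a \<le> R'" "c \<le> R'" "d \<le> R'" "0 \<le> R'" using sum d(1) assms(2) by linarith+
  show thesis
  proof (rule that[of D])
    fix x y :: real assume xy: "x \<in> {0..1}" "y \<in> {0..1}"
    show "\<bar>D ?m x - D ?m y\<bar> \<le> R' * \<bar>x - y\<bar> powr (\<beta> - real ?m)"
    proof (cases "x = y")
      case False
      have "c * \<bar>x - y\<bar> powr (\<beta> - real ?m) \<le> R' * \<bar>x - y\<bar> powr (\<beta> - real ?m)"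
        using le by (intro mult_right_mono) auto
      then show ?thesis using c[rule_format, OF xy False] by linarith
    qed auto
  next
    fix j :: nat and x :: real assume j: "1 \<le> j" "real j < \<beta>" and x: "x \<in> {0..1}"
    have "d ^ j * \<bar>f x\<bar> powr (\<beta> - real j) \<le> R' ^ j * f x powr (\<beta> - real j)"
      using nn x d(1) le by (auto intro!: mult_right_mono power_mono)
    then show "\<bar>D j x\<bar> powr \<beta> \<le> R' ^ j * f x powr (\<beta> - real j)"
      using d(2)[rule_format, OF conjI[OF j] x] by linarith
  next
    fix x :: real assume "x \<in> {0..1}"
    then show "f x \<le> R'" using a[rule_format, of x] le by linarith
  qed (use D0 der nn in auto)
qed

lemma H_ball_nonneg: "H_ball \<beta> R f \<Longrightarrow> x \<in> {0..1} \<Longrightarrow> 0 \<le> f x"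
  by (simp add: H_ball_def)

lemma H_ball_continuous_on:
  assumes "H_ball \<beta> R f" "0 < \<beta>"
  shows "continuous_on {0..1} f"
proof -
  obtain D where D: "\<And>k x. k < lfloor \<beta> \<Longrightarrow> x \<in> {0..1} \<Longrightarrow> (D k has_real_derivative D (Suc k) x) (at x within {0..1})"
    and H: "\<And>x y. x \<in> {0..1} \<Longrightarrow> y \<in> {0..1} \<Longrightarrow>
        \<bar>D (lfloor \<beta>) x - D (lfloor \<beta>) y\<bar> \<le> R * \<bar>x - y\<bar> powr (\<beta> - real (lfloor \<beta>))"
    and "\<And>j x. 1 \<le> j \<Longrightarrow> real j < \<beta> \<Longrightarrow> x \<in> {0..1} \<Longrightarrow>
        \<bar>D j x\<bar> powr \<beta> \<le> R ^ j * f x powr (\<beta> - real j)"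
    and D0: "\<And>x. x \<in> {0..1} \<Longrightarrow> D 0 x = f x"
    and "\<And>x. x \<in> {0..1} \<Longrightarrow> 0 \<le> f x" "\<And>x. x \<in> {0..1} \<Longrightarrow> f x \<le> R"
    using H_ballE[OF assms(1) order_refl assms(2)] by blast
  have "continuous_on {0..1} (D 0)"
  proof (cases "lfloor \<beta> = 0")
    case False
    then show ?thesis using D[of 0] by (intro DERIV_continuous_on) auto
  next
    case True
    have "((D 0) \<longlongrightarrow> D 0 x) (at x within {0..1})" if x: "x \<in> {0..1}" for x
    proof -
      have "((\<lambda>y. \<bar>y - x\<bar> powr \<beta>) \<longlongrightarrow> 0 powr \<beta>) (at x within {0..1})"
        using assms(2) by (intro tendsto_powr2 tendsto_eq_intros) (auto intro!: tendsto_eq_intros)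
      then have "((\<lambda>y. R * \<bar>y - x\<bar> powr \<beta>) \<longlongrightarrow> 0) (at x within {0..1})"
        using tendsto_mult_right_zero by fastforce
      then have "((\<lambda>y. D 0 y - D 0 x) \<longlongrightarrow> 0) (at x within {0..1})"
        by (rule Lim_null_comparison[rotated])
          (use H x True in \<open>auto simp: eventually_at_filter\<close>)
      then show ?thesis by (simp add: LIM_zero_iff)
    qed
    then show ?thesis by (simp add: continuous_on_def)
  qed
  then show ?thesis using D0 continuous_on_cong[of "{0..1}" "{0..1}" "D 0" f] by simp
qed

text \<open>The Taylor polynomial is padded with zeros to degree below \<open>S\<close>, so its
  length no longer depends on \<beta>. The coefficient bound is the \<beta>-th root of the flatness
  condition, with \<open>R' powr (i / \<beta>)\<close> enlarged to a constant free of
  \<open>i\<close> and \<beta>.\<close>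

lemma H_ball_local_expansion:
  assumes H: "H_ball \<beta> R f" and R: "R \<le> R'" "1 \<le> R'" and \<beta>: "0 < \<beta>1" "\<beta>1 \<le> \<beta>" "\<beta> < real S"
    and x: "x \<in> {0..1}"
  obtains d where "d 0 = f x" "\<And>i. i < S \<Longrightarrow> real i < \<beta> \<or> d i = 0"
    "\<And>i. i < S \<Longrightarrow> \<bar>d i\<bar> \<le> R' powr (real S / \<beta>1) * f x powr (1 - real i / \<beta>)"
    "\<And>t. t \<in> {0..1} \<Longrightarrow> \<bar>f t - (\<Sum>i<S. d i * (t - x) ^ i)\<bar> \<le> R' * \<bar>t - x\<bar> powr \<beta>"
proof -
  have b0: "0 < \<beta>" using \<beta> by linarith
  let ?m = "lfloor \<beta>"
  have m: "real ?m < \<beta>" "\<beta> \<le> real ?m + 1" using lfloor_bounds[OF b0] by auto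
  then have mS: "?m < S" using \<beta>(3) by linarith
  obtain D where der: "\<And>k x. k < ?m \<Longrightarrow> x \<in> {0..1} \<Longrightarrow> (D k has_real_derivative D (Suc k) x) (at x within {0..1})"
    and Hol: "\<And>x y. x \<in> {0..1} \<Longrightarrow> y \<in> {0..1} \<Longrightarrow>
        \<bar>D ?m x - D ?m y\<bar> \<le> R' * \<bar>x - y\<bar> powr (\<beta> - real ?m)"
    and sem: "\<And>j x. 1 \<le> j \<Longrightarrow> real j < \<beta> \<Longrightarrow> x \<in> {0..1} \<Longrightarrow>
        \<bar>D j x\<bar> powr \<beta> \<le> R' ^ j * f x powr (\<beta> - real j)"
    and D0: "\<And>x. x \<in> {0..1} \<Longrightarrow> D 0 x = f x" and nn: "\<And>x. x \<in> {0..1} \<Longrightarrow> 0 \<le> f x"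
      and "\<And>x. x \<in> {0..1} \<Longrightarrow> f x \<le> R'"
    using H_ballE[OF H R(1) b0] by blast
  note D0x = D0[OF x]
  define d where "d i = (if i \<le> ?m then D i x / fact i else 0)" for i
  let ?K = "R' powr (real S / \<beta>1)"
  have K1: "1 \<le> ?K" using R \<beta> by (intro ge_one_powr_ge_zero) auto
  show thesis
  proof (rule that[of d])
    show "d 0 = f x" using D0x by (simp add: d_def)
    fix i assume i: "i < S"
    show "real i < \<beta> \<or> d i = 0" using m by (auto simp: d_def)
    show "\<bar>d i\<bar> \<le> ?K * f x powr (1 - real i / \<beta>)"
    proof (cases "i \<le> ?m \<and> 1 \<le> i")
      case False
      then show ?thesis using K1 nn[OF x] D0x by (auto simp: d_def not_less_eq_eq mult_le_cancel_right1)
    next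
      case True
      then have ib: "real i < \<beta>" using m by linarith
      have "\<bar>D i x\<bar> = (\<bar>D i x\<bar> powr \<beta>) powr (1 / \<beta>)" using b0 by (simp add: powr_powr)
      also have "\<dots> \<le> (R' ^ i * f x powr (\<beta> - real i)) powr (1 / \<beta>)"
        using sem[of i x] True ib x b0 by (intro powr_mono2) auto
      also have "\<dots> = R' powr (real i / \<beta>) * f x powr (1 - real i / \<beta>)"
        using R b0 by (simp add: powr_mult powr_powr powr_realpow[symmetric] diff_divide_distrib)
      also have "\<dots> \<le> ?K * f x powr (1 - real i / \<beta>)"
        using R i \<beta> by (intro mult_right_mono powr_mono frac_le) auto
      finally have "\<bar>D i x\<bar> \<le> ?K * f x powr (1 - real i / \<beta>)" .
      moreover have "\<bar>d i\<bar> \<le> \<bar>D i x\<bar>"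
        using True fact_ge_1[of i, where 'a=real] mult_left_mono[of 1 "fact i" "\<bar>D i x\<bar>"] by (simp add: d_def abs_divide divide_le_eq)
      ultimately show ?thesis by linarith
    qed
  next
    fix t :: real assume t: "t \<in> {0..1}"
    have "(\<Sum>i<S. d i * (t - x) ^ i) = (\<Sum>i\<le>?m. d i * (t - x) ^ i)"
      using mS by (intro sum.mono_neutral_right) (auto simp: d_def)
    also have "\<dots> = (\<Sum>i\<le>?m. D i x / fact i * (t - x) ^ i)"
      by (intro sum.cong) (auto simp: d_def)
    finally show "\<bar>f t - (\<Sum>i<S. d i * (t - x) ^ i)\<bar> \<le> R' * \<bar>t - x\<bar> powr \<beta>"
      using Taylor_Hoelder_remainder[OF der Hol _ _ x t] R m D0[OF t] by simp
  qed
qed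

text \<open>Once \<open>r powr \<beta>\<close> dominates \<open>f x\<close>, each term
  \<open>f x powr (1 - i / \<beta>) * r ^ i\<close> of the expansion is at most
  \<open>r powr \<beta>\<close>: near a small value, \<open>f\<close> cannot grow faster than its
  smoothness allows.\<close>

lemma H_ball_local_upper_bound:
  assumes H: "H_ball \<beta> R f" and R: "R \<le> R'" "1 \<le> R'" and \<beta>: "0 < \<beta>1" "\<beta>1 \<le> \<beta>" "\<beta> < real S"
    and x: "x \<in> {0..1}" and t: "t \<in> {0..1}" and r: "0 < r" "\<bar>t - x\<bar> \<le> r" "f x \<le> r powr \<beta>"
  shows "f t \<le> (real S * R' powr (real S / \<beta>1) + R') * r powr \<beta>"
proof -
  let ?K = "R' powr (real S / \<beta>1)"
  obtain d where "d 0 = f x" and d: "\<And>i. i < S \<Longrightarrow> real i < \<beta> \<or> d i = 0"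
    "\<And>i. i < S \<Longrightarrow> \<bar>d i\<bar> \<le> ?K * f x powr (1 - real i / \<beta>)"
    "\<And>t. t \<in> {0..1} \<Longrightarrow> \<bar>f t - (\<Sum>i<S. d i * (t - x) ^ i)\<bar> \<le> R' * \<bar>t - x\<bar> powr \<beta>"
    using H_ball_local_expansion[OF assms(1-7)] by blast
  have b0: "0 < \<beta>" using \<beta> by linarith
  have "\<bar>\<Sum>i<S. d i * (t - x) ^ i\<bar> \<le> (\<Sum>i<S. ?K * r powr \<beta>)"
  proof (rule order_trans[OF sum_abs sum_mono])
    fix i assume "i \<in> {..<S}"
    then have i: "i < S" by simp
    show "\<bar>d i * (t - x) ^ i\<bar> \<le> ?K * r powr \<beta>"
    proof (cases "d i = 0")
      case False
      then have ib: "real i < \<beta>" using d(1) i by blast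
      \<comment> \<open>Monotonicity of the power requires a nonnegative exponent; this holds since
        nonzero coefficients occur only for \<open>i < \<beta>\<close>.\<close>
      have "f x powr (1 - real i / \<beta>) \<le> (r powr \<beta>) powr (1 - real i / \<beta>)"
        using ib b0 r H_ball_nonneg[OF H x] by (intro powr_mono2) auto
      also have "\<dots> = r powr (\<beta> - real i)" using b0 by (simp add: powr_powr algebra_simps)
      finally have "\<bar>d i\<bar> \<le> ?K * r powr (\<beta> - real i)"
        using d(2)[OF i] by (meson mult_left_mono order_trans powr_ge_zero)
      moreover have "\<bar>(t - x) ^ i\<bar> \<le> r powr real i"
        using r by (simp add: power_abs powr_realpow power_mono)
      ultimately have "\<bar>d i * (t - x) ^ i\<bar> \<le> (?K * r powr (\<beta> - real i)) * r powr real i"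
        unfolding abs_mult by (intro mult_mono) auto
      then show ?thesis using r by (simp add: powr_diff)
    qed auto
  qed
  moreover have "R' * \<bar>t - x\<bar> powr \<beta> \<le> R' * r powr \<beta>"
    using R r b0 by (intro mult_left_mono powr_mono2) auto
  ultimately show ?thesis using d(3)[OF t] by (simp add: algebra_simps)
qed

text \<open>In the variable \<open>s = (t - x) / \<rho>\<close> the function
  \<open>f t / f x\<close> has constant term 1 and uniformly bounded coefficients, so the polynomial
  square root applies for \<open>\<bar>s\<bar> \<le> e\<close>. Its error is passed from squares to
  roots by the difference of squares, without differentiating \<open>sqrt f\<close>.\<close>

lemma H_ball_sqrt_local_polynomial:
  fixes R' \<beta>1 :: real
  assumes R': "1 \<le> R'" and \<beta>1: "0 < \<beta>1" and S: "0 < S"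
  shows "\<exists>K>0. \<exists>e>0. e \<le> 1 \<and> (\<forall>\<beta> R f x r. H_ball \<beta> R f \<longrightarrow> R \<le> R' \<longrightarrow> \<beta>1 \<le> \<beta> \<longrightarrow> \<beta> < real S \<longrightarrow>
     x \<in> {0..1} \<longrightarrow> 0 < f x \<longrightarrow> 0 < r \<longrightarrow> r \<le> e * f x powr (1 / \<beta>) \<longrightarrow>
     (\<exists>p. \<forall>t\<in>{0..1}. \<bar>t - x\<bar> \<le> r \<longrightarrow>
        \<bar>sqrt (f t) - (\<Sum>i<S. p i * (t - x) ^ i)\<bar> \<le> K * r powr \<beta> / sqrt (f x)))"
proof -
  obtain m where m: "S = Suc m" using S by (cases S) auto
  let ?K = "R' powr (real S / \<beta>1)"
  obtain B e where B: "0 < B" and e: "0 < e" "e \<le> 1" and ex: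
    "\<And>q :: nat \<Rightarrow> real. q 0 = 1 \<Longrightarrow> (\<forall>i\<le>m. \<bar>q i\<bar> \<le> ?K) \<Longrightarrow>
     (\<exists>p. \<forall>s. \<bar>s\<bar> \<le> e \<longrightarrow> 1 / 2 \<le> (\<Sum>i\<le>m. p i * s ^ i) \<and>
        \<bar>(\<Sum>i\<le>m. p i * s ^ i)\<^sup>2 - (\<Sum>i\<le>m. q i * s ^ i)\<bar> \<le> B * \<bar>s\<bar> ^ Suc m)"
    using polynomial_sqrt_approx[of m ?K] by blast
  have "\<exists>p. \<forall>t\<in>{0..1}. \<bar>t - x\<bar> \<le> r \<longrightarrow>
        \<bar>sqrt (f t) - (\<Sum>i<S. p i * (t - x) ^ i)\<bar> \<le> (2 * (B + R')) * r powr \<beta> / sqrt (f x)"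
    if H: "H_ball \<beta> R f" "R \<le> R'" "\<beta>1 \<le> \<beta>" "\<beta> < real S" "x \<in> {0..1}" and fx: "0 < f x"
      and r: "0 < r" "r \<le> e * f x powr (1 / \<beta>)" for \<beta> R f x r
  proof -
    have b0: "0 < \<beta>" using H \<beta>1 by linarith
    define \<rho> where "\<rho> = f x powr (1 / \<beta>)"
    have \<rho>: "0 < \<rho>" "\<rho> powr \<beta> = f x" using fx b0 by (auto simp: \<rho>_def powr_powr)
    obtain d where d: "d 0 = f x" "\<And>i. i < S \<Longrightarrow> real i < \<beta> \<or> d i = 0" "\<And>i. i < S \<Longrightarrow> \<bar>d i\<bar> \<le> ?K * f x powr (1 - real i / \<beta>)"
      "\<And>t. t \<in> {0..1} \<Longrightarrow> \<bar>f t - (\<Sum>i<S. d i * (t - x) ^ i)\<bar> \<le> R' * \<bar>t - x\<bar> powr \<beta>"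
      using H_ball_local_expansion[OF H(1,2) R' \<beta>1 H(3-5)] by blast
    \<comment> \<open>These are the coefficients of the normalised expansion of
      \<open>f (x + \<rho> * s) / f x\<close>; since
      \<open>\<rho> ^ i = f x powr (i / \<beta>)\<close>, the powers of \<open>f x\<close> cancel in
      the bound.\<close>
    define q where "q i = d i * \<rho> ^ i / f x" for i
    have "q 0 = 1" using d(1) fx by (simp add: q_def)
    moreover have "\<bar>q i\<bar> \<le> ?K" if "i \<le> m" for i
    proof -
      have "\<rho> ^ i = f x powr (real i / \<beta>)"
        using fx \<rho>(1) by (simp add: powr_realpow[symmetric] \<rho>_def powr_powr)
      then have "f x powr (1 - real i / \<beta>) * \<rho> ^ i = f x" using fx by (simp add: powr_diff)
      then have "\<bar>d i\<bar> * \<rho> ^ i \<le> ?K * f x"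
        using mult_right_mono[OF d(3)[of i], of "\<rho> ^ i"] that m \<rho>(1) by (simp add: mult.assoc)
      then show ?thesis using fx \<rho>(1) by (simp add: q_def abs_mult divide_le_eq)
    qed
    ultimately obtain p where p: "\<And>s. \<bar>s\<bar> \<le> e \<Longrightarrow> 1 / 2 \<le> (\<Sum>i\<le>m. p i * s ^ i)"
      "\<And>s. \<bar>s\<bar> \<le> e \<Longrightarrow> \<bar>(\<Sum>i\<le>m. p i * s ^ i)\<^sup>2 - (\<Sum>i\<le>m. q i * s ^ i)\<bar> \<le> B * \<bar>s\<bar> ^ Suc m"
      using ex[of q] by blast
    show ?thesis
    proof (intro exI[of _ "\<lambda>i. sqrt (f x) * p i / \<rho> ^ i"] ballI impI)
      fix t :: real assume t: "t \<in> {0..1}" and tr: "\<bar>t - x\<bar> \<le> r"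
      define s where "s = (t - x) / \<rho>"
      define P where "P = (\<Sum>i\<le>m. p i * s ^ i)"
      have sr: "\<bar>s\<bar> \<le> r / \<rho>" using tr \<rho> by (simp add: s_def divide_right_mono)
      also have "r / \<rho> \<le> e" using r \<rho> by (simp add: \<rho>_def[symmetric] divide_le_eq)
      finally have se: "\<bar>s\<bar> \<le> e" .
      have r1: "r / \<rho> \<le> 1" using \<open>r / \<rho> \<le> e\<close> e by linarith
      have "\<bar>s\<bar> ^ Suc m \<le> (r / \<rho>) ^ Suc m" using sr by (intro power_mono) auto
      also have "\<dots> = (r / \<rho>) powr real S" using r \<rho> m by (subst powr_realpow) auto
      \<comment> \<open>As \<open>r / \<rho> \<le> 1\<close> and \<open>\<beta> < S\<close>, the
        truncation error of order \<open>S\<close> is absorbed into the Hoelder error of order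
        \<beta>.\<close>
      also have "\<dots> \<le> (r / \<rho>) powr \<beta>" using r1 r \<rho> H(4) by (intro powr_mono') auto
      also have eq: "(r / \<rho>) powr \<beta> = r powr \<beta> / f x" using r \<rho> by (simp add: powr_divide)
      finally have sS: "\<bar>s\<bar> ^ Suc m \<le> r powr \<beta> / f x" .
      have sumq: "(\<Sum>i<S. d i * (t - x) ^ i) = f x * (\<Sum>i\<le>m. q i * s ^ i)"
        unfolding sum_distrib_left m lessThan_Suc_atMost q_def s_def
        using fx \<rho> by (intro sum.cong) (auto simp: power_divide)
      have "f x * \<bar>f t / f x - (\<Sum>i\<le>m. q i * s ^ i)\<bar> = \<bar>f t - (\<Sum>i<S. d i * (t - x) ^ i)\<bar>"
        unfolding sumq using fx by (simp add: abs_mult_pos' right_diff_distrib)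
      also have "\<dots> \<le> R' * r powr \<beta>"
        using d(4)[OF t] tr R' b0 by (meson abs_ge_zero less_imp_le mult_left_mono order_trans powr_mono2 zero_le_one)
      finally have "\<bar>f t / f x - (\<Sum>i\<le>m. q i * s ^ i)\<bar> \<le> R' * r powr \<beta> / f x"
        using fx by (simp add: field_simps)
      moreover have "\<bar>P\<^sup>2 - (\<Sum>i\<le>m. q i * s ^ i)\<bar> \<le> B * (r powr \<beta> / f x)"
        using p(2)[OF se] mult_left_mono[OF sS, of B] B unfolding P_def by linarith
      ultimately have PP: "\<bar>f t / f x - P\<^sup>2\<bar> \<le> (B + R') * r powr \<beta> / f x"
        by (simp add: algebra_simps add_divide_distrib)
      have ft: "0 \<le> f t" using H_ball_nonneg H(1) t by blast
      have P2: "1 / 2 \<le> P" using p(1)[OF se] by (simp add: P_def)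
      let ?u = "sqrt (f t / f x)"
      have u0: "0 \<le> ?u" using ft fx by simp
      have uP0: "1 / 2 \<le> ?u + P" using P2 u0 by linarith
      \<comment> \<open>Here \<open>?u - P\<close> equals
        \<open>(?u\<^sup>2 - P\<^sup>2) / (?u + P)\<close>, and \<open>?u + P\<close> is at least
        \<open>1 / 2\<close> because of \<open>P\<close>, even where \<open>f t\<close> vanishes.
        This produces the factor 2 in the constant.\<close>
      then have "\<bar>?u - P\<bar> * (1 / 2) \<le> \<bar>?u - P\<bar> * (?u + P)"
        by (intro mult_left_mono) auto
      also have "\<dots> = \<bar>(?u - P) * (?u + P)\<bar>"
        using uP0 unfolding abs_mult by linarith
      also have "(?u - P) * (?u + P) = f t / f x - P\<^sup>2"
        using ft fx by (simp add: algebra_simps power2_eq_square[symmetric])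
      also note PP
      finally have uP: "\<bar>?u - P\<bar> \<le> 2 * ((B + R') * r powr \<beta> / f x)"
        using mult_left_mono[of "\<bar>?u - P\<bar> * (1 / 2)" _ 2] by (simp add: mult_ac)
      have "(\<Sum>i<S. sqrt (f x) * p i / \<rho> ^ i * (t - x) ^ i) = sqrt (f x) * P"
        unfolding P_def sum_distrib_left m lessThan_Suc_atMost s_def by (simp add: power_divide mult.assoc)
      moreover have "sqrt (f t) = sqrt (f x) * ?u" using fx by (simp add: real_sqrt_divide)
      ultimately have "\<bar>sqrt (f t) - (\<Sum>i<S. sqrt (f x) * p i / \<rho> ^ i * (t - x) ^ i)\<bar> = sqrt (f x) * \<bar>?u - P\<bar>"
        using fx by (simp add: abs_mult right_diff_distrib[symmetric])
      also have "\<dots> \<le> sqrt (f x) * (2 * ((B + R') * r powr \<beta> / f x))"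
        using uP fx by (intro mult_left_mono) auto
      also have "\<dots> = 2 * (B + R') * r powr \<beta> / sqrt (f x)"
      proof -
        have "s * (2 * (L / (s * s))) = 2 * L / s" if "0 < s" for s L :: real
          using that by (simp add: field_simps)
        from this[of "sqrt (f x)" "(B + R') * r powr \<beta>"] fx show ?thesis by (simp only: mult.assoc) simp
      qed
      finally show "\<bar>sqrt (f t) - (\<Sum>i<S. sqrt (f x) * p i / \<rho> ^ i * (t - x) ^ i)\<bar>
         \<le> 2 * (B + R') * r powr \<beta> / sqrt (f x)" .
    qed
  qed
  moreover have "0 < 2 * (B + R')" using B R' by simp
  ultimately show ?thesis using e by blast
qed

subsection \<open>Wavelet coefficients of the square root of f\<close>

lemma localized_integral_bound:
  fixes w g :: "real \<Rightarrow> real"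
  assumes w: "continuous_on {0..1} w" and g: "continuous_on {0..1} g"
    and A: "\<And>t. t \<in> {0..1} \<Longrightarrow> \<bar>w t\<bar> \<le> A"
    and B: "\<And>t. t \<in> {0..1} \<Longrightarrow> \<bar>t - x\<bar> \<le> r \<Longrightarrow> \<bar>g t\<bar> \<le> B"
    and supp: "\<And>t. t \<in> {0..1} \<Longrightarrow> w t \<noteq> 0 \<Longrightarrow> \<bar>t - x\<bar> \<le> r" and "0 \<le> r" "0 \<le> A" "0 \<le> B"
  shows "\<bar>LINT t:{0..1}|lborel. w t * g t\<bar> \<le> 2 * r * (A * B)"
proof -
  have "norm (LINT t|lborel. indicator {0..1} t *\<^sub>R (w t * g t)) \<le> (LINT t|lborel. indicator {x - r..x + r} t * (A * B))"
  proof (rule order_trans[OF integral_norm_bound integral_mono])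
    show "integrable lborel (\<lambda>t. norm (indicator {0..1} t *\<^sub>R (w t * g t)))"
      using borel_integrable_atLeastAtMost'[of 0 1 "\<lambda>t. w t * g t"] w g
      by (intro integrable_norm) (simp add: set_integrable_def continuous_on_mult)
    show "integrable lborel (\<lambda>t. indicat_real {x - r..x + r} t * (A * B))"
      by (intro integrable_mult_left integrable_real_indicator) (auto simp: emeasure_lborel_Icc_eq)
    fix t :: real
    show "norm (indicator {0..1} t *\<^sub>R (w t * g t)) \<le> indicator {x - r..x + r} t * (A * B)"
    proof (cases "t \<in> {0..1} \<and> w t \<noteq> 0")
      case True
      then have "\<bar>t - x\<bar> \<le> r" using supp by blast
      then have "t \<in> {x - r..x + r}" by auto
      moreover have "\<bar>w t * g t\<bar> \<le> A * B"
        unfolding abs_mult using True A B \<open>\<bar>t - x\<bar> \<le> r\<close> assms by (intro mult_mono) auto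
      ultimately show ?thesis using True by simp
    qed (use assms in auto)
  qed
  also have "\<dots> = 2 * r * (A * B)" using \<open>0 \<le> r\<close> by simp
  finally show ?thesis by (simp add: set_lebesgue_integral_def)
qed

text \<open>Moments vanish for powers of \<open>t\<close>, whereas the local polynomials are centred
  at \<open>x\<close>. Splitting one factor \<open>t - x\<close> at a time lowers \<open>i\<close>,
  but raises a power of \<open>t\<close>; the induction therefore carries the extra factor
  \<open>t ^ a\<close>.\<close>

lemma vanishing_moments_shifted_polynomial:
  fixes w :: "real \<Rightarrow> real"
  assumes w: "continuous_on {0..1} w" and mom: "\<And>m. m < S \<Longrightarrow> (LINT t:{0..1}|lborel. w t * t ^ m) = 0"
  shows "(LINT t:{0..1}|lborel. w t * (\<Sum>i<S. p i * (t - x) ^ i)) = 0"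
proof -
  have int: "set_integrable lborel {0..1} (\<lambda>t. w t * h t)" if "continuous_on {0..1} h" for h
    using that w by (intro borel_integrable_atLeastAtMost' continuous_on_mult)
  have *: "(LINT t:{0..1}|lborel. w t * (t ^ a * (t - x) ^ i)) = 0" if "a + i < S" for a i
    using that
  proof (induction i arbitrary: a)
    case 0
    then show ?case using mom by simp
  next
    case (Suc i)
    have "(LINT t:{0..1}|lborel. w t * (t ^ a * (t - x) ^ Suc i)) =
       (LINT t:{0..1}|lborel. w t * (t ^ Suc a * (t - x) ^ i) - x * (w t * (t ^ a * (t - x) ^ i)))"
      by (simp add: algebra_simps)
    also have "\<dots> = (LINT t:{0..1}|lborel. w t * (t ^ Suc a * (t - x) ^ i)) - (LINT t:{0..1}|lborel. x * (w t * (t ^ a * (t - x) ^ i)))"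
      by (intro set_integral_diff set_integrable_mult_right int continuous_intros)
    also have "\<dots> = 0"
      using Suc.IH[of "Suc a"] Suc.IH[of a] Suc.prems by simp
    finally show ?case .
  qed
  have "(LINT t:{0..1}|lborel. w t * (\<Sum>i<S. p i * (t - x) ^ i)) =
        (LINT t:{0..1}|lborel. (\<Sum>i<S. p i * (w t * (t - x) ^ i)))"
    by (simp add: sum_distrib_left algebra_simps)
  also have "\<dots> = (\<Sum>i<S. (LINT t:{0..1}|lborel. p i * (w t * (t - x) ^ i)))"
    unfolding set_lebesgue_integral_def scaleR_sum_right
    by (intro Bochner_Integration.integral_sum)
      (intro int[unfolded set_integrable_def] set_integrable_mult_right[unfolded set_integrable_def] continuous_intros)
  also have "\<dots> = 0" using *[of 0] by simp
  finally show ?thesis .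
qed

text \<open>With \<open>\<rho> = f x powr (1 / \<beta>)\<close>: on scales \<open>s\<close> below a multiple of \<open>\<rho>\<close> the moments annihilate the
  local polynomial approximation of \<open>sqrt f\<close>; on coarser scales \<open>f\<close> is itself of order
  \<open>s powr \<beta>\<close> on the support of \<open>w\<close>. Both regimes yield both inequalities.\<close>

lemma sqrt_coefficient_bounds:
  fixes c \<beta>1 R2 :: real
  assumes \<beta>1: "0 < \<beta>1" and S: "0 < S" and c: "0 < c"
  shows "\<exists>K>0. \<forall>\<beta> R f x s w. H_ball \<beta> R f \<longrightarrow> R \<le> R2 \<longrightarrow> \<beta>1 \<le> \<beta> \<longrightarrow> \<beta> < real S \<longrightarrow> x \<in> {0..1} \<longrightarrow>
     0 < s \<longrightarrow> continuous_on {0..1} w \<longrightarrow> (\<forall>t\<in>{0..1}. \<bar>w t\<bar> \<le> c / sqrt s) \<longrightarrow>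
     (\<forall>t\<in>{0..1}. w t \<noteq> 0 \<longrightarrow> \<bar>t - x\<bar> \<le> 2 * c * s) \<longrightarrow>
     (s < 2 \<longrightarrow> (\<forall>m<S. (LINT t:{0..1}|lborel. w t * t ^ m) = 0)) \<longrightarrow>
     \<bar>LINT t:{0..1}|lborel. w t * sqrt (f t)\<bar> \<le> K * s powr ((\<beta> + 1) / 2) \<and>
     sqrt (f x) * \<bar>LINT t:{0..1}|lborel. w t * sqrt (f t)\<bar> \<le> K * s powr (\<beta> + 1 / 2)"
proof -
  define R' where "R' = max 1 R2"
  have R': "1 \<le> R'" "R2 \<le> R'" by (auto simp: R'_def)
  obtain K0 e0 where K0: "0 < K0" and e0: "0 < e0" "e0 \<le> 1" and approx:
    "\<And>\<beta> R f x r. H_ball \<beta> R f \<Longrightarrow> R \<le> R' \<Longrightarrow> \<beta>1 \<le> \<beta> \<Longrightarrow> \<beta> < real S \<Longrightarrow>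
     x \<in> {0..1} \<Longrightarrow> 0 < f x \<Longrightarrow> 0 < r \<Longrightarrow> r \<le> e0 * f x powr (1 / \<beta>) \<Longrightarrow>
     (\<exists>p. \<forall>t\<in>{0..1}. \<bar>t - x\<bar> \<le> r \<longrightarrow>
        \<bar>sqrt (f t) - (\<Sum>i<S. p i * (t - x) ^ i)\<bar> \<le> K0 * r powr \<beta> / sqrt (f x))"
    using H_ball_sqrt_local_polynomial[OF R'(1) \<beta>1 S] by blast
  \<comment> \<open>The second bound forces \<open>s < 2\<close> in the fine-scale regime, excluding the scaling functions.\<close>
  define e where "e = min e0 (c / R' powr (1 / \<beta>1))"
  have e: "0 < e" "e \<le> e0" "e \<le> 1" "e \<le> c / R' powr (1 / \<beta>1)"
    using e0 c R' by (auto simp: e_def)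
  \<comment> \<open>In the coarse regime \<open>\<rho>\<close> is below
    \<open>r / e = (2 * c / e) * s\<close>, so \<open>L * s\<close> dominates both
    \<open>\<rho>\<close> and the support radius \<open>2 * c * s\<close>.\<close>
  define L where "L = max 1 (2 * c / e)"
  have L: "1 \<le> L" "2 * c / e \<le> L" "2 * c \<le> L"
  proof -
    show "1 \<le> L" "2 * c / e \<le> L" by (auto simp: L_def)
    moreover have "2 * c * 1 \<le> 2 * c * (1 / e)" using e c by (intro mult_left_mono) auto
    ultimately show "2 * c \<le> L" by simp
  qed
  define Q where "Q = real S * R' powr (real S / \<beta>1) + R'"
  have Q: "1 \<le> Q" using R' by (simp add: Q_def add_increasing)
  \<comment> \<open>In the fine regime \<open>s \<le> \<rho> / (2 * c)\<close>, hence
    \<open>s powr (\<beta> / 2) \<le> M * sqrt (f x)\<close>.\<close>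
  define M where "M = max 1 (1 / (2 * c)) powr real S"
  have M: "1 \<le> M" by (auto simp: M_def intro!: ge_one_powr_ge_zero)
  \<comment> \<open>One summand for each regime; \<open>4 * c\<^sup>2\<close> arises from
    \<open>2 * r * c / sqrt s\<close> with \<open>r = 2 * c * s\<close>.\<close>
  define K where "K = 4 * c\<^sup>2 * (K0 * L powr real S * M + Q * L powr real S)"
  have LS: "1 \<le> L powr real S" using L by (intro ge_one_powr_ge_zero) auto
  have Kpos: "0 < K" using c K0 Q LS M unfolding K_def
    by (intro mult_pos_pos add_pos_pos) auto
  have main: "\<bar>LINT t:{0..1}|lborel. w t * sqrt (f t)\<bar> \<le> K * s powr ((\<beta> + 1) / 2) \<and>
     sqrt (f x) * \<bar>LINT t:{0..1}|lborel. w t * sqrt (f t)\<bar> \<le> K * s powr (\<beta> + 1 / 2)"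
    if H: "H_ball \<beta> R f" "R \<le> R2" "\<beta>1 \<le> \<beta>" "\<beta> < real S" "x \<in> {0..1}" and s: "0 < s"
      and w: "continuous_on {0..1} w" "\<And>t. t \<in> {0..1} \<Longrightarrow> \<bar>w t\<bar> \<le> c / sqrt s"
      "\<And>t. t \<in> {0..1} \<Longrightarrow> w t \<noteq> 0 \<Longrightarrow> \<bar>t - x\<bar> \<le> 2 * c * s"
      "s < 2 \<Longrightarrow> \<forall>m<S. (LINT t:{0..1}|lborel. w t * t ^ m) = 0" for \<beta> R f x s w
  proof -
    let ?th = "LINT t:{0..1}|lborel. w t * sqrt (f t)"
    have b0: "0 < \<beta>" using H \<beta>1 by linarith
    have RR: "R \<le> R'" using H R' by linarith
    have nn: "\<And>t. t \<in> {0..1} \<Longrightarrow> 0 \<le> f t" using H_ball_nonneg[OF H(1)] .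
    have fR: "f x \<le> R'" using H_ballE[OF H(1) RR b0] H(5) by blast
    have cf: "continuous_on {0..1} (\<lambda>t. sqrt (f t))"
      using H_ball_continuous_on[OF H(1) b0] by (intro continuous_intros)
    define r where "r = 2 * c * s"
    have r0: "0 < r" using c s by (simp add: r_def)
    have half: "2 * r * (c / sqrt s * B) = 4 * c\<^sup>2 * sqrt s * B" for B
    proof -
      have "s / sqrt s = sqrt s" using s by (simp add: real_div_sqrt)
      moreover have "2 * (2 * c * s) * (c / sqrt s * B) = 4 * (c * c) * (s / sqrt s) * B" by simp
      ultimately show ?thesis unfolding r_def power2_eq_square by metis
    qed
    have pw: "sqrt s = s powr (1 / 2)" using s by (simp add: powr_half_sqrt)
    define \<rho> where "\<rho> = f x powr (1 / \<beta>)"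
    have \<rho>\<beta>: "\<rho> powr \<beta> = f x" using nn[OF H(5)] b0 by (simp add: \<rho>_def powr_powr)
    have Lb: "L powr \<beta> \<le> L powr real S" using L H(4) by (intro powr_mono) auto
    have e1: "s powr (\<beta> + 1 / 2) = sqrt s * s powr \<beta>" using s by (simp add: pw powr_add)
    have e2: "s powr ((\<beta> + 1) / 2) = sqrt s * s powr (\<beta> / 2)" using s by (simp add: pw powr_add[symmetric] add_divide_distrib add.commute)
    have e3: "s powr \<beta> = s powr (\<beta> / 2) * s powr (\<beta> / 2)" by (simp add: powr_add[symmetric])
    show ?thesis
    \<comment> \<open>If \<open>f x = 0\<close> then \<open>\<rho> = 0\<close>, so zeros of
      \<open>f\<close> fall into the second case at every scale and the divisions by
      \<open>sqrt (f x)\<close> in the first are safe.\<close>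
    proof (cases "r \<le> e * \<rho>")
      case True
      have \<rho>0: "0 < \<rho>" using True r0 e by (smt (verit, best) mult_nonneg_nonpos zero_less_mult_pos)
      then have fx: "0 < f x" using nn[OF H(5)] by (auto simp: \<rho>_def less_le)
      have "\<rho> \<le> R' powr (1 / \<beta>)" unfolding \<rho>_def using nn[OF H(5)] fR b0 by (intro powr_mono2) auto
      also have "\<dots> \<le> R' powr (1 / \<beta>1)" using R' H(3) \<beta>1 by (intro powr_mono frac_le) auto
      finally have "e * \<rho> \<le> (c / R' powr (1 / \<beta>1)) * R' powr (1 / \<beta>1)"
        using e \<rho>0 by (intro mult_mono) auto
      also have "\<dots> = c" using R' by simp
      finally have "2 * c * s \<le> c" using True by (simp add: r_def)
      then have "c * (2 * s) \<le> c * 1" by simp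
      then have s2: "s < 2" using c by (simp only: mult_le_cancel_left_pos)
      have "r \<le> e0 * \<rho>" using True mult_right_mono[OF e(2), of \<rho>] \<rho>0 by linarith
      then obtain p where p: "\<And>t. t \<in> {0..1} \<Longrightarrow> \<bar>t - x\<bar> \<le> r \<Longrightarrow>
        \<bar>sqrt (f t) - (\<Sum>i<S. p i * (t - x) ^ i)\<bar> \<le> K0 * r powr \<beta> / sqrt (f x)"
        using approx[OF H(1) RR H(3,4,5) fx r0] unfolding \<rho>_def by blast
      define P where "P t = (\<Sum>i<S. p i * (t - x) ^ i)" for t
      have cP: "continuous_on {0..1} P" unfolding P_def by (intro continuous_intros)
      have "?th = (LINT t:{0..1}|lborel. w t * sqrt (f t)) - (LINT t:{0..1}|lborel. w t * P t)"
        using vanishing_moments_shifted_polynomial[OF w(1), of S p x] w(4)[OF s2] unfolding P_def by simp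
      also have "\<dots> = (LINT t:{0..1}|lborel. w t * sqrt (f t) - w t * P t)"
        by (intro set_integral_diff(2)[symmetric] borel_integrable_atLeastAtMost' continuous_on_mult w(1) cf cP)
      also have "\<dots> = (LINT t:{0..1}|lborel. w t * (sqrt (f t) - P t))" by (simp add: right_diff_distrib)
      finally have "\<bar>?th\<bar> \<le> 2 * r * (c / sqrt s * (K0 * r powr \<beta> / sqrt (f x)))"
        using localized_integral_bound[OF w(1) continuous_on_diff[OF cf cP] w(2), of x r "K0 * r powr \<beta> / sqrt (f x)"]
          p w(3) r0 c s K0 fx unfolding P_def r_def by simp
      also have "\<dots> = 4 * c\<^sup>2 * sqrt s * (K0 * r powr \<beta> / sqrt (f x))" by (rule half)
      finally have th: "\<bar>?th\<bar> * sqrt (f x) \<le> 4 * c\<^sup>2 * sqrt s * (K0 * r powr \<beta>)"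
        using fx by (simp add: pos_le_divide_eq)
      have "r powr \<beta> = (2 * c) powr \<beta> * s powr \<beta>" using c s by (simp add: r_def powr_mult)
      also have "\<dots> \<le> L powr real S * s powr \<beta>"
        using L c b0 Lb by (intro mult_right_mono order_trans[OF powr_mono2 Lb]) auto
      finally have rb: "r powr \<beta> \<le> L powr real S * s powr \<beta>" .
      have "4 * c\<^sup>2 * sqrt s * (K0 * r powr \<beta>) \<le> 4 * c\<^sup>2 * sqrt s * (K0 * (L powr real S * s powr \<beta>))"
        using rb K0 s by (intro mult_left_mono) auto
      with th have th2: "\<bar>?th\<bar> * sqrt (f x) \<le> (4 * c\<^sup>2 * (K0 * L powr real S)) * (sqrt s * s powr \<beta>)"
        by (simp add: mult_ac)
      let ?k = "4 * c\<^sup>2 * (K0 * L powr real S)"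
      have k0: "0 \<le> ?k" using K0 by simp
      have kM: "?k * M \<le> K" using Q LS c unfolding K_def by (simp add: algebra_simps)
      have "?k * 1 \<le> ?k * M" using k0 M by (intro mult_left_mono) auto
      then have kK: "?k \<le> K" using kM by linarith
      have "\<bar>?th\<bar> * sqrt (f x) \<le> K * (sqrt s * s powr \<beta>)"
        by (rule order_trans[OF th2 mult_right_mono[OF kK]]) (use s in simp)
      then have two: "sqrt (f x) * \<bar>?th\<bar> \<le> K * s powr (\<beta> + 1 / 2)"
        unfolding e1 by (simp only: mult.commute[of "sqrt (f x)"])
      \<comment> \<open>The unweighted bound follows from the weighted one: half of
        \<open>s powr \<beta>\<close> is exchanged for \<open>M * sqrt (f x)\<close>, and
        \<open>sqrt (f x)\<close> then cancels.\<close>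
      have "s \<le> (1 / (2 * c)) * \<rho>"
      proof -
        have "2 * c * s \<le> 1 * \<rho>" using True e(3) \<rho>0 mult_right_mono[of e 1 \<rho>] unfolding r_def by linarith
        then show ?thesis using c by (simp add: field_simps)
      qed
      also have "\<dots> \<le> max 1 (1 / (2 * c)) * \<rho>" using \<rho>0 by (intro mult_right_mono) auto
      finally have "s powr (\<beta> / 2) \<le> (max 1 (1 / (2 * c)) * \<rho>) powr (\<beta> / 2)"
        using s b0 by (intro powr_mono2) auto
      also have "\<dots> = max 1 (1 / (2 * c)) powr (\<beta> / 2) * sqrt (f x)"
      proof -
        have "\<rho> powr (\<beta> / 2) = sqrt (f x)"
          using fx b0 by (simp add: \<rho>_def powr_powr powr_half_sqrt)
        then show ?thesis using \<rho>0 c by (subst powr_mult) auto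
      qed
      also have "\<dots> \<le> M * sqrt (f x)" unfolding M_def
        using H(4) b0 fx by (intro mult_right_mono powr_mono) auto
      finally have sM: "s powr (\<beta> / 2) \<le> M * sqrt (f x)" .
      have "?k * (sqrt s * s powr \<beta>) = (?k * sqrt s * s powr (\<beta> / 2)) * s powr (\<beta> / 2)"
        by (simp add: e3 mult_ac)
      also have "\<dots> \<le> (?k * sqrt s * s powr (\<beta> / 2)) * (M * sqrt (f x))"
        using sM K0 s by (intro mult_left_mono mult_nonneg_nonneg) auto
      finally have "\<bar>?th\<bar> * sqrt (f x) \<le> (?k * M * (sqrt s * s powr (\<beta> / 2))) * sqrt (f x)"
        using th2 by (simp add: mult_ac)
      then have "\<bar>?th\<bar> \<le> ?k * M * (sqrt s * s powr (\<beta> / 2))" using fx by simp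
      also have "\<dots> \<le> K * (sqrt s * s powr (\<beta> / 2))" using kM s by (intro mult_right_mono) auto
      finally have "\<bar>?th\<bar> \<le> K * s powr ((\<beta> + 1) / 2)" unfolding e2 .
      then show ?thesis using two by blast
    next
      case False
      \<comment> \<open>No cancellation is used on coarse scales: \<open>f\<close> is at most of
        order \<open>r' powr \<beta>\<close> throughout the support, and the size of the wavelet
        finishes the estimate.\<close>
      define r' where "r' = L * s"
      have r': "0 < r'" "r \<le> r'" "\<rho> \<le> r'"
      proof -
        show "0 < r'" "r \<le> r'" using L s by (auto simp: r'_def r_def)
        have "\<rho> \<le> r / e" using False e by (simp add: pos_le_divide_eq mult.commute)
        also have "r / e = (2 * c / e) * s" by (simp add: r_def)
        also have "\<dots> \<le> r'" unfolding r'_def using L s by (intro mult_right_mono) auto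
        finally show "\<rho> \<le> r'" .
      qed
      have fr: "f x \<le> r' powr \<beta>"
        using powr_mono2[of \<beta> \<rho> r'] r' b0 \<rho>\<beta> by (simp add: \<rho>_def)
      have sq: "sqrt (r' powr \<beta>) = r' powr (\<beta> / 2)" by (simp add: powr_half_sqrt[symmetric] powr_powr)
      have bd: "\<bar>sqrt (f t)\<bar> \<le> Q * r' powr (\<beta> / 2)" if "t \<in> {0..1}" "\<bar>t - x\<bar> \<le> r" for t
      proof -
        have "f t \<le> Q * r' powr \<beta>" unfolding Q_def
          using H_ball_local_upper_bound[OF H(1) RR R'(1) \<beta>1 H(3,4,5) that(1) r'(1) _ fr] that(2) r' by simp
        then have "sqrt (f t) \<le> sqrt Q * r' powr (\<beta> / 2)"
          using real_sqrt_le_mono[of "f t" "Q * r' powr \<beta>"] by (simp add: real_sqrt_mult sq)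
        also have "\<dots> \<le> Q * r' powr (\<beta> / 2)"
        proof -
          have "Q * 1 \<le> Q * Q" using Q by (intro mult_left_mono) auto
          then have "sqrt Q \<le> Q" using Q by (intro real_le_lsqrt) (auto simp: power2_eq_square)
          then show ?thesis by (intro mult_right_mono) auto
        qed
        finally show ?thesis using nn[OF that(1)] by simp
      qed
      have "\<bar>?th\<bar> \<le> 2 * r * (c / sqrt s * (Q * r' powr (\<beta> / 2)))"
        by (rule localized_integral_bound[OF w(1) cf w(2) bd])
          (use w(3) r0 c s Q in \<open>auto simp: r_def\<close>)
      also have "\<dots> = 4 * c\<^sup>2 * sqrt s * (Q * r' powr (\<beta> / 2))" by (rule half)
      finally have th: "\<bar>?th\<bar> \<le> 4 * c\<^sup>2 * sqrt s * (Q * r' powr (\<beta> / 2))" .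
      have r'h: "r' powr (\<beta> / 2) = L powr (\<beta> / 2) * s powr (\<beta> / 2)"
        using L s by (simp add: r'_def powr_mult)
      have Lh: "L powr (\<beta> / 2) \<le> L powr real S" using L H(4) b0 by (intro powr_mono) auto
      let ?k = "4 * c\<^sup>2 * Q"
      have k0: "0 \<le> ?k" using Q by simp
      have kK: "?k * L powr real S \<le> K" using K0 M LS unfolding K_def by (simp add: algebra_simps)
      have "\<bar>?th\<bar> \<le> (?k * L powr (\<beta> / 2)) * (sqrt s * s powr (\<beta> / 2))"
        using th unfolding r'h by (simp add: mult_ac)
      also have "\<dots> \<le> (?k * L powr real S) * (sqrt s * s powr (\<beta> / 2))"
        using Lh k0 Q s by (intro mult_right_mono mult_left_mono) auto
      also have "\<dots> \<le> K * (sqrt s * s powr (\<beta> / 2))" using kK s by (intro mult_right_mono) auto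
      finally have one: "\<bar>?th\<bar> \<le> K * s powr ((\<beta> + 1) / 2)" unfolding e2 .
      \<comment> \<open>Here the weighted bound comes from the unweighted one, since
        \<open>sqrt (f x)\<close> is itself of order \<open>s powr (\<beta> / 2)\<close>.\<close>
      have "sqrt (f x) \<le> r' powr (\<beta> / 2)" using real_sqrt_le_mono[OF fr] sq by simp
      then have "sqrt (f x) * \<bar>?th\<bar> \<le> r' powr (\<beta> / 2) * (4 * c\<^sup>2 * sqrt s * (Q * r' powr (\<beta> / 2)))"
        using th by (intro mult_mono) auto
      also have "\<dots> = ?k * sqrt s * (r' powr (\<beta> / 2) * r' powr (\<beta> / 2))" by (simp add: mult_ac)
      also have "r' powr (\<beta> / 2) * r' powr (\<beta> / 2) = L powr \<beta> * s powr \<beta>"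
        using L s powr_mult[of L s \<beta>] powr_add[of r' "\<beta> / 2" "\<beta> / 2"] by (simp add: r'_def)
      also have "?k * sqrt s * (L powr \<beta> * s powr \<beta>) = (?k * L powr \<beta>) * (sqrt s * s powr \<beta>)" by (simp add: mult_ac)
      also have "\<dots> \<le> (?k * L powr real S) * (sqrt s * s powr \<beta>)"
        using Lb k0 Q s by (intro mult_right_mono mult_left_mono) auto
      also have "\<dots> \<le> K * (sqrt s * s powr \<beta>)" using kK s by (intro mult_right_mono) auto
      finally show ?thesis using one unfolding e1 by blast
    qed
  qed
  show ?thesis
    by (rule exI[of _ K], intro conjI[OF Kpos] allI impI) (rule main; blast)
qed

subsection \<open>Wavelet expansions\<close>

text \<open>The constant hidden by the existential quantifier in \<open>wavelet_basis\<close>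
  becomes the parameter \<open>c\<close>, so that later constants can be built from it.\<close>

locale wavelet_system =
  fixes S :: nat and \<psi> :: "int \<Rightarrow> int \<Rightarrow> real \<Rightarrow> real" and I :: "int \<Rightarrow> int set" and c :: real
  assumes c_pos: "0 < c"
    and index_card: "\<And>j. -1 \<le> j \<Longrightarrow> finite (I j) \<and> real (card (I j)) \<le> c * 2 powr (real_of_int j)"
    and psi: "\<And>j k. -1 \<le> j \<Longrightarrow> k \<in> I j \<Longrightarrow>
        \<psi> j k \<in> borel_measurable borel \<and> continuous_on {0..1} (\<psi> j k) \<and>
        (\<forall>x\<in>{0..1}. \<bar>\<psi> j k x\<bar> \<le> c * 2 powr (real_of_int j / 2)) \<and>
        (\<exists>a. \<forall>x\<in>{0..1}. \<psi> j k x \<noteq> 0 \<longrightarrow> \<bar>x - a\<bar> \<le> c * 2 powr (- real_of_int j))"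
    and overlap: "\<And>j x. -1 \<le> j \<Longrightarrow> x \<in> {0..1} \<Longrightarrow> real (card {k\<in>I j. \<psi> j k x \<noteq> 0}) \<le> c"
    and orthonormal: "\<And>j k j' k'. -1 \<le> j \<Longrightarrow> k \<in> I j \<Longrightarrow> -1 \<le> j' \<Longrightarrow> k' \<in> I j' \<Longrightarrow>
        (LINT t:{0..1}|lborel. \<psi> j k t * \<psi> j' k' t) = (if j = j' \<and> k = k' then 1 else 0)"
    and complete: "\<And>g. g \<in> borel_measurable borel \<Longrightarrow> set_integrable lborel {0..1} (\<lambda>t. (g t)\<^sup>2) \<Longrightarrow>
        (\<And>j k. -1 \<le> j \<Longrightarrow> k \<in> I j \<Longrightarrow> (LINT t:{0..1}|lborel. \<psi> j k t * g t) = 0) \<Longrightarrow>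
        (AE t in lborel. t \<in> {0..1} \<longrightarrow> g t = 0)"
    and moments: "\<And>j k m. 0 \<le> j \<Longrightarrow> k \<in> I j \<Longrightarrow> m < S \<Longrightarrow> (LINT t:{0..1}|lborel. \<psi> j k t * t ^ m) = 0"

lemma wavelet_basis_imp_system:
  assumes "wavelet_basis S \<psi> I"
  obtains c where "wavelet_system S \<psi> I c"
proof (rule exE[OF assms[unfolded wavelet_basis_def]])
  fix c assume *: "0 < c \<and>
   (\<forall>j\<ge>-1. finite (I j) \<and> real (card (I j)) \<le> c * 2 powr (real_of_int j)) \<and>
   (\<forall>j\<ge>-1. \<forall>k\<in>I j.
      \<psi> j k \<in> borel_measurable borel \<and> continuous_on {0..1} (\<psi> j k) \<and>
      (\<forall>x\<in>{0..1}. \<bar>\<psi> j k x\<bar> \<le> c * 2 powr (real_of_int j / 2)) \<and>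
      (\<exists>a. \<forall>x\<in>{0..1}. \<psi> j k x \<noteq> 0 \<longrightarrow> \<bar>x - a\<bar> \<le> c * 2 powr (- real_of_int j))) \<and>
   (\<forall>j\<ge>-1. \<forall>x\<in>{0..1}. real (card {k\<in>I j. \<psi> j k x \<noteq> 0}) \<le> c) \<and>
   (\<forall>j\<ge>-1. \<forall>k\<in>I j. \<forall>j'\<ge>-1. \<forall>k'\<in>I j'.
      (LINT t:{0..1}|lborel. \<psi> j k t * \<psi> j' k' t) = (if j = j' \<and> k = k' then 1 else 0)) \<and>
   (\<forall>g. g \<in> borel_measurable borel \<longrightarrow> set_integrable lborel {0..1} (\<lambda>t. (g t)\<^sup>2) \<longrightarrow>
      (\<forall>j\<ge>-1. \<forall>k\<in>I j. (LINT t:{0..1}|lborel. \<psi> j k t * g t) = 0) \<longrightarrow>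
      (AE t in lborel. t \<in> {0..1} \<longrightarrow> g t = 0)) \<and>
   (\<forall>j\<ge>0. \<forall>k\<in>I j. \<forall>m<S. (LINT t:{0..1}|lborel. \<psi> j k t * t ^ m) = 0)"
  note c = *[THEN conjunct1] and r1 = *[THEN conjunct2]
  note p1 = r1[THEN conjunct1, rule_format] and r2 = r1[THEN conjunct2]
  note p2 = r2[THEN conjunct1, rule_format] and r3 = r2[THEN conjunct2]
  note p3 = r3[THEN conjunct1, rule_format] and r4 = r3[THEN conjunct2]
  note p4 = r4[THEN conjunct1, rule_format] and r5 = r4[THEN conjunct2]
  note p5 = r5[THEN conjunct1, rule_format] and p6 = r5[THEN conjunct2, rule_format]
  have "wavelet_system S \<psi> I c"
  proof
    show "0 < c" by (rule c)
  qed (rule p1 p2 p3 p4 p5 p6; assumption)+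
  then show thesis by (rule that)
qed

context wavelet_system
begin

lemma finite_index: "-1 \<le> j \<Longrightarrow> finite (I j)"
  using index_card by blast

lemma psi_continuous: "-1 \<le> j \<Longrightarrow> k \<in> I j \<Longrightarrow> continuous_on {0..1} (\<psi> j k)"
  using psi by blast

lemma psi_bound: "-1 \<le> j \<Longrightarrow> k \<in> I j \<Longrightarrow> x \<in> {0..1} \<Longrightarrow> \<bar>\<psi> j k x\<bar> \<le> c * 2 powr (real_of_int j / 2)"
  using psi by blast

lemma psi_support:
  assumes "-1 \<le> j" "k \<in> I j" "x \<in> {0..1}" "\<psi> j k x \<noteq> 0" "t \<in> {0..1}" "\<psi> j k t \<noteq> 0"
  shows "\<bar>t - x\<bar> \<le> 2 * c * 2 powr (- real_of_int j)"
proof -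
  obtain a where a: "\<And>x. x \<in> {0..1} \<Longrightarrow> \<psi> j k x \<noteq> 0 \<Longrightarrow> \<bar>x - a\<bar> \<le> c * 2 powr (- real_of_int j)"
    using psi[OF assms(1,2)] by blast
  show ?thesis using a[OF assms(3,4)] a[OF assms(5,6)] by linarith
qed

text \<open>Completeness yields equality almost everywhere only. The summable bound \<open>b\<close>
  makes the series converge uniformly to a continuous \<open>F\<close> with the same coefficients as
  \<open>g\<close>; continuity then turns almost everywhere equality into equality at each point.
  The index \<open>i\<close> stands for level \<open>i - 1\<close>, as levels start at -1.\<close>

lemma wavelet_expansion:
  fixes g :: "real \<Rightarrow> real"
  assumes g: "continuous_on {0..1} g"
    and b: "summable b" and bound: "\<And>i x. x \<in> {0..1} \<Longrightarrow>
       \<bar>\<Sum>k\<in>I (int i - 1). (LINT t:{0..1}|lborel. \<psi> (int i - 1) k t * g t) * \<psi> (int i - 1) k x\<bar> \<le> b i"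
    and x: "x \<in> {0..1}"
  shows "(\<lambda>i. \<Sum>k\<in>I (int i - 1). (LINT t:{0..1}|lborel. \<psi> (int i - 1) k t * g t) * \<psi> (int i - 1) k x) sums g x"
proof -
  define \<theta> where "\<theta> j k = (LINT t:{0..1}|lborel. \<psi> j k t * g t)" for j k
  define p where "p i x = (\<Sum>k\<in>I (int i - 1). \<theta> (int i - 1) k * \<psi> (int i - 1) k x)" for i x
  define F where "F x = (\<Sum>i. p i x)" for x
  note fin = finite_index and c\<psi> = psi_continuous
  have LI: "(LINT t:{0..1}|lborel. h t) = integral {0..1} h" if "continuous_on {0..1} h" for h :: "real \<Rightarrow> real"
    using that by (intro set_borel_integral_eq_integral(2) borel_integrable_atLeastAtMost')
  have orth: "integral {0..1} (\<lambda>t. \<psi> j k t * \<psi> j' k' t) = (if j = j' \<and> k = k' then 1 else 0)"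
    if "j \<ge> -1" "k \<in> I j" "j' \<ge> -1" "k' \<in> I j'" for j k j' k'
  proof -
    have "(LINT t:{0..1}|lborel. \<psi> j k t * \<psi> j' k' t) = (if j = j' \<and> k = k' then 1 else 0)"
      using orthonormal that by blast
    then show ?thesis using LI[of "\<lambda>t. \<psi> j k t * \<psi> j' k' t"] c\<psi> that by (simp add: continuous_on_mult)
  qed
  have cp: "continuous_on {0..1} (p i)" for i unfolding p_def
    by (intro continuous_intros c\<psi>) auto
  have bd: "\<bar>p i y\<bar> \<le> b i" if "y \<in> {0..1}" for i y
    using bound[OF that] by (simp add: p_def \<theta>_def)
  have UF: "uniform_limit {0..1} (\<lambda>n x. \<Sum>i<n. p i x) F sequentially"
    unfolding F_def by (rule Weierstrass_m_test[OF _ b]) (use bd in auto)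
  have cF: "continuous_on {0..1} F"
    by (rule uniform_limit_theorem[OF _ UF]) (auto intro!: always_eventually continuous_on_sum cp)
  have sm: "(\<lambda>i. p i y) sums F y" if "y \<in> {0..1}" for y
    unfolding F_def by (rule summable_sums, rule summable_comparison_test[OF _ b]) (use bd that in auto)
  have coef: "integral {0..1} (\<lambda>t. \<psi> j k t * F t) = \<theta> j k" if j: "j \<ge> -1" and k: "k \<in> I j" for j k
  proof -
    define A where "A = c * 2 powr (real_of_int j / 2)"
    have A: "\<bar>\<psi> j k t\<bar> \<le> A" if "t \<in> {0..1}" for t
      using psi_bound[OF j k that] by (simp add: A_def)
    \<comment> \<open>Multiplication by the bounded function \<open>\<psi> j k\<close> preserves
      uniform convergence, so the series may be integrated term by term; by orthonormality only
      level \<open>j\<close> survives.\<close>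
    have "uniform_limit {0..1} (\<lambda>n t. \<Sum>i<n. \<psi> j k t * p i t) (\<lambda>t. \<Sum>i. \<psi> j k t * p i t) sequentially"
    proof (rule Weierstrass_m_test)
      show "summable (\<lambda>i. A * b i)" using b by (rule summable_mult)
      fix i and t :: real assume "t \<in> {0..1}"
      then show "norm (\<psi> j k t * p i t) \<le> A * b i"
        using A[of t] bd[of t i] by (simp add: abs_mult mult_mono')
    qed
    moreover have "(\<Sum>i. \<psi> j k t * p i t) = \<psi> j k t * F t" if "t \<in> {0..1}" for t
      using sums_mult[OF sm[OF that], of "\<psi> j k t"] by (simp add: sums_iff)
    ultimately have "uniform_limit {0..1} (\<lambda>n t. \<Sum>i<n. \<psi> j k t * p i t) (\<lambda>t. \<psi> j k t * F t) sequentially"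
      unfolding uniform_limit_iff by simp
    then obtain In Jn where In: "\<And>n. ((\<lambda>t. \<Sum>i<n. \<psi> j k t * p i t) has_integral In n) {0..1}"
      and Jn: "((\<lambda>t. \<psi> j k t * F t) has_integral Jn) {0..1}" and lim: "In \<longlonglongrightarrow> Jn"
      by (rule uniform_limit_integral[where a = 0 and b = 1])
        (auto intro!: continuous_on_sum continuous_on_mult c\<psi>[OF j k] cp)
    have one: "integral {0..1} (\<lambda>t. \<psi> j k t * p i t) = (if i = nat (j + 1) then \<theta> j k else 0)" for i
    proof -
      have "integral {0..1} (\<lambda>t. \<psi> j k t * p i t) =
          integral {0..1} (\<lambda>t. \<Sum>k'\<in>I (int i - 1). \<theta> (int i - 1) k' * (\<psi> j k t * \<psi> (int i - 1) k' t))"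
        unfolding p_def by (simp add: sum_distrib_left mult_ac)
      also have "\<dots> = (\<Sum>k'\<in>I (int i - 1). integral {0..1} (\<lambda>t. \<theta> (int i - 1) k' * (\<psi> j k t * \<psi> (int i - 1) k' t)))"
        by (intro integral_sum integrable_continuous_interval continuous_intros c\<psi> j k fin) auto
      also have "\<dots> = (\<Sum>k'\<in>I (int i - 1). \<theta> (int i - 1) k' * (if j = int i - 1 \<and> k = k' then 1 else 0))"
        using orth[OF j k] by (intro sum.cong) auto
      also have "\<dots> = (if i = nat (j + 1) then \<theta> j k else 0)"
      proof (cases "j = int i - 1")
        case True
        then have "(\<Sum>k'\<in>I (int i - 1). \<theta> (int i - 1) k' * (if j = int i - 1 \<and> k = k' then 1 else 0)) =
          (\<Sum>k'\<in>I j. if k = k' then \<theta> j k' else 0)" by (intro sum.cong) auto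
        then show ?thesis using True fin[OF j] k by simp
      next
        case False
        then have "i \<noteq> nat (j + 1)" using j by auto
        then show ?thesis using False by simp
      qed
      finally show ?thesis .
    qed
    have "In n = (if nat (j + 1) < n then \<theta> j k else 0)" for n
    proof -
      have "In n = integral {0..1} (\<lambda>t. \<Sum>i<n. \<psi> j k t * p i t)"
        using In[of n] by (simp add: integral_unique)
      also have "\<dots> = (\<Sum>i<n. integral {0..1} (\<lambda>t. \<psi> j k t * p i t))"
        by (intro integral_sum integrable_continuous_interval continuous_intros c\<psi> j k cp) auto
      finally show ?thesis by (simp add: one)
    qed
    then have "eventually (\<lambda>n. In n = \<theta> j k) sequentially"
      by (intro eventually_sequentiallyI[of "Suc (nat (j + 1))"]) (simp add: Suc_le_eq)
    then have "In \<longlonglongrightarrow> \<theta> j k" by (rule tendsto_eventually)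
    then have "Jn = \<theta> j k" using lim LIMSEQ_unique by blast
    then show ?thesis using Jn by (simp add: integral_unique)
  qed
  \<comment> \<open>\<open>F - g\<close> is controlled on the unit interval only; extension by zero
    makes it Borel measurable on the whole line, as \<open>complete\<close> demands.\<close>
  define G where "G t = indicator {0..1} t *\<^sub>R (F t - g t)" for t
  have cG: "continuous_on {0..1} (\<lambda>t. F t - g t)" using cF g by (rule continuous_on_diff)
  have "G \<in> borel_measurable borel"
    unfolding G_def by (rule borel_measurable_continuous_on_indicator[OF _ cG]) auto
  moreover have "set_integrable lborel {0..1} (\<lambda>t. (G t)\<^sup>2)"
  proof -
    have "set_integrable lborel {0..1} (\<lambda>t. (F t - g t)\<^sup>2)"
      using cG by (intro borel_integrable_atLeastAtMost' continuous_on_power)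
    then show ?thesis by (rule set_integrable_cong[THEN iffD1, rotated -1]) (auto simp: G_def)
  qed
  moreover have "(LINT t:{0..1}|lborel. \<psi> j k t * G t) = 0" if "j \<ge> -1" "k \<in> I j" for j k
  proof -
    have "(LINT t:{0..1}|lborel. \<psi> j k t * G t) = (LINT t:{0..1}|lborel. \<psi> j k t * (F t - g t))"
      by (rule set_lebesgue_integral_cong) (auto simp: G_def)
    also have "\<dots> = integral {0..1} (\<lambda>t. \<psi> j k t * (F t - g t))"
      by (intro LI continuous_on_mult c\<psi> that cG)
    also have "\<dots> = integral {0..1} (\<lambda>t. \<psi> j k t * F t) - integral {0..1} (\<lambda>t. \<psi> j k t * g t)"
      unfolding right_diff_distrib
      by (intro Henstock_Kurzweil_Integration.integral_diff integrable_continuous_interval continuous_on_mult c\<psi> that cF g)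
    also have "\<dots> = 0" using coef[OF that] LI[of "\<lambda>t. \<psi> j k t * g t"] c\<psi>[OF that] g
      by (simp add: \<theta>_def continuous_on_mult)
    finally show ?thesis .
  qed
  ultimately have ae: "AE t in lborel. t \<in> {0..1} \<longrightarrow> G t = 0"
    by (rule complete)
  \<comment> \<open>A continuous nonnegative function with zero integral over the interval vanishes
    identically, endpoints included.\<close>
  have "(LINT t:{0..1}|lborel. \<bar>F t - g t\<bar>) = 0"
    unfolding set_lebesgue_integral_def
    by (rule integral_eq_zero_AE, use ae in eventually_elim) (auto simp: G_def indicator_def)
  then have "integral {0..1} (\<lambda>t. \<bar>F t - g t\<bar>) = 0"
    using LI[of "\<lambda>t. \<bar>F t - g t\<bar>"] cG by (simp add: continuous_on_rabs)
  moreover have "(\<lambda>t. \<bar>F t - g t\<bar>) integrable_on {0..1}"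
    using cG by (intro integrable_continuous_interval continuous_on_rabs)
  ultimately have "((\<lambda>t. \<bar>F t - g t\<bar>) has_integral 0) (cbox 0 1)"
    by (metis box_real(2) integrable_integral)
  from has_integral_0_cbox_imp_0[OF _ _ this, of x] have "\<bar>F x - g x\<bar> = 0"
    using cG x by (simp add: continuous_on_rabs)
  then show ?thesis using sm[OF x] by (simp add: p_def \<theta>_def)
qed

end

section \<open>Sums over scales and a Gaussian tail bound\<close>

text \<open>The growing bound \<open>A * 2 powr (i / 2)\<close> and the decaying bound
  \<open>2 powr (- \<gamma> * i)\<close> cross where \<open>2 ^ i\<close> equals
  \<open>A powr (- 2 / (2 * \<gamma> + 1))\<close>, and both are then
  \<open>A powr (2 * \<gamma> / (2 * \<gamma> + 1))\<close>. Two geometric series on either side of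
  the crossing are comparable to this value. The hypothesis \<open>T\<close> puts the crossing
  within the levels where \<open>e1\<close> is available.\<close>

lemma sum_min_geometric_le:
  fixes A K \<gamma> \<gamma>0 :: real and e :: "nat \<Rightarrow> real"
  assumes \<gamma>: "0 < \<gamma>0" "\<gamma>0 \<le> \<gamma>" and A: "0 < A" and K: "0 \<le> K"
    and e1: "\<And>i. i \<le> J + 1 \<Longrightarrow> e i \<le> K * (A * 2 powr (real i / 2))"
    and e2: "\<And>i. e i \<le> K * 2 powr (- (\<gamma> * real i))"
    and T: "A powr (- 2 / (2 * \<gamma> + 1)) \<le> 2 ^ (J + 2)"
  shows "(\<Sum>i<L. e i) \<le> K * (4 + 1 / (1 - 2 powr - \<gamma>0)) * A powr (2 * \<gamma> / (2 * \<gamma> + 1))"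
proof -
  define T where "T = A powr (- 2 / (2 * \<gamma> + 1))"
  \<comment> \<open>The first integer level at or past the crossing; every \<open>i < N\<close>
    satisfies \<open>2 ^ i < T\<close> and hence \<open>i \<le> J + 1\<close>.\<close>
  define N where "N = (LEAST N. T \<le> 2 ^ N)"
  define q :: real where "q = sqrt 2"
  define z where "z = 2 powr - \<gamma>"
  have g0: "0 < \<gamma>" using \<gamma> by linarith
  have T0: "0 < T" using A by (simp add: T_def)
  have TN: "T \<le> 2 ^ N" unfolding N_def by (rule LeastI[of _ "J + 2"]) (use T in \<open>simp add: T_def\<close>)
  have lN: "2 ^ i < T" if "i < N" for i using not_less_Least[of i "\<lambda>N. T \<le> 2 ^ N"] that by (simp add: N_def)
  have iJ: "i \<le> J + 1" if "i < N" for i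
  proof -
    have "(2::real) ^ i < 2 ^ (J + 2)" using lN[OF that] T by (simp add: T_def)
    then have "i < J + 2" by (rule power_less_imp_less_exp[rotated]) simp
    then show ?thesis by simp
  qed
  \<comment> \<open>This rational bound suffices for \<open>q / (q - 1) \<le> 4\<close>, the origin
    of the 4 in the constant.\<close>
  have q: "4 / 3 \<le> q" unfolding q_def by (rule real_le_rsqrt) (simp add: power2_eq_square)
  have qp: "2 powr (real i / 2) = q ^ i" for i
    by (simp add: q_def powr_half_sqrt[symmetric] powr_powr powr_realpow[symmetric])
  have zp: "2 powr (- (\<gamma> * real i)) = z ^ i" for i
    by (simp add: z_def powr_powr powr_realpow[symmetric])
  have z: "0 < z" "z \<le> 2 powr - \<gamma>0" "z < 1" "2 powr - \<gamma>0 < 1"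
    using \<gamma> g0 by (auto simp: z_def powr_less_one)
  define M where "M = A powr (2 * \<gamma> / (2 * \<gamma> + 1))"
  have half: "2 / (4 * \<gamma> + 2) = 1 / (2 * \<gamma> + 1)" using g0 by (simp add: field_simps)
  have "A * sqrt T = A powr 1 * A powr (- 1 / (2 * \<gamma> + 1))"
    using A by (simp add: T_def powr_half_sqrt[symmetric] powr_powr half)
  also have "\<dots> = M" unfolding M_def powr_add[symmetric] using g0 by (simp add: field_simps)
  finally have AT: "A * sqrt T = M" .
  have TM: "T powr - \<gamma> = M" using g0 by (simp add: T_def M_def powr_powr mult.commute)
  have M0: "0 \<le> M" by (simp add: M_def)
  have low: "(\<Sum>i<N. A * q ^ i) \<le> 4 * M"
  proof (cases N)
    case 0
    then show ?thesis using M0 by simp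
  next
    case (Suc m)
    have qm: "q ^ m \<le> sqrt T"
    proof -
      have "q ^ m = sqrt (2 ^ m)" by (simp add: q_def real_sqrt_power)
      also have "\<dots> \<le> sqrt T" using lN[of m] Suc by simp
      finally show ?thesis .
    qed
    have "(\<Sum>i<N. q ^ i) = (q ^ N - 1) / (q - 1)" using q by (subst sum_gp_strict) (auto simp: field_simps)
    also have "\<dots> \<le> (q ^ m * q) / (q - 1)" using q Suc by (intro divide_right_mono) auto
    also have "\<dots> = q ^ m * (q / (q - 1))" by simp
    also have "\<dots> \<le> q ^ m * 4" using q by (intro mult_left_mono) (auto simp: divide_le_eq)
    also have "\<dots> \<le> sqrt T * 4" using qm by simp
    finally have "A * (\<Sum>i<N. q ^ i) \<le> A * (sqrt T * 4)" using A by (intro mult_left_mono) auto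
    also have "\<dots> = 4 * M" using AT by simp
    finally show ?thesis by (simp add: sum_distrib_left)
  qed
  have high: "(\<Sum>i\<in>{N..<N + L}. z ^ i) \<le> M / (1 - 2 powr - \<gamma>0)"
  proof -
    have "(\<Sum>i\<in>{N..<N + L}. z ^ i) = z ^ N * (\<Sum>i<L. z ^ i)"
      using sum.shift_bounds_nat_ivl[of "\<lambda>i. z ^ i" 0 N L]
      by (simp add: power_add sum_distrib_left atLeast0LessThan mult.commute add.commute)
    also have "(\<Sum>i<L. z ^ i) = (1 - z ^ L) / (1 - z)" using z by (simp add: sum_gp_strict)
    also have "\<dots> \<le> 1 / (1 - 2 powr - \<gamma>0)" using z by (intro frac_le) auto
    also have "z ^ N * (1 / (1 - 2 powr - \<gamma>0)) = z ^ N / (1 - 2 powr - \<gamma>0)" by simp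
    also have "\<dots> \<le> M / (1 - 2 powr - \<gamma>0)"
    proof (rule divide_right_mono)
      have "z ^ N = (2 ^ N) powr - \<gamma>" using zp[of N] by (simp add: powr_powr powr_realpow[symmetric] mult.commute)
      also have "\<dots> \<le> T powr - \<gamma>" using TN T0 g0 by (intro powr_mono2') auto
      finally show "z ^ N \<le> M" by (simp add: TM)
    qed (use z in auto)
    finally show ?thesis using z by (simp add: mult_left_mono)
  qed
  have "(\<Sum>i<L. e i) \<le> (\<Sum>i<L. K * (if i < N then A * q ^ i else z ^ i))"
    using e1 e2 iJ by (intro sum_mono) (auto simp: qp zp)
  also have "\<dots> = K * (\<Sum>i<L. if i < N then A * q ^ i else z ^ i)" by (simp add: sum_distrib_left)
  \<comment> \<open>Enlarging the range to \<open>N + L\<close> terms avoids a comparison of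
    \<open>L\<close> with \<open>N\<close>.\<close>
  also have "(\<Sum>i<L. if i < N then A * q ^ i else z ^ i) \<le>
      (\<Sum>i\<in>{..<N} \<union> {N..<N + L}. if i < N then A * q ^ i else z ^ i)"
    using A q z by (intro sum_mono2) auto
  also have "\<dots> = (\<Sum>i<N. if i < N then A * q ^ i else z ^ i) + (\<Sum>i\<in>{N..<N + L}. if i < N then A * q ^ i else z ^ i)"
    by (intro sum.union_disjoint) auto
  also have "\<dots> = (\<Sum>i<N. A * q ^ i) + (\<Sum>i\<in>{N..<N + L}. z ^ i)"
    by (intro arg_cong2[where f = "(+)"] sum.cong) auto
  also have "\<dots> \<le> (4 + 1 / (1 - 2 powr - \<gamma>0)) * M" using low high by (simp add: distrib_right)
  finally show ?thesis using K by (simp add: M_def mult_left_mono mult.assoc)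
qed

text \<open>Where \<open>\<bar>x\<bar> > u\<close>, half of the exponent
  \<open>x\<^sup>2 / 2\<close> is bounded by \<open>u\<^sup>2 / 4\<close>; the other half is, up to
  the factor \<open>sqrt 2\<close>, the normal density of variance 2, which integrates to 1. The
  noise level chosen below leaves room for this halved exponent.\<close>

lemma std_normal_abs_tail:
  assumes M: "prob_space M" and X: "distributed M lborel X (\<lambda>x. ennreal (normal_density 0 1 x))" and u: "0 \<le> u"
  shows "measure M {\<omega> \<in> space M. u < \<bar>X \<omega>\<bar>} \<le> sqrt 2 * exp (- u\<^sup>2 / 4)"
proof -
  interpret prob_space M by (rule M)
  let ?A = "{x::real. u < \<bar>x\<bar>}"
  have pt: "normal_density 0 1 x * indicator ?A x \<le> (sqrt 2 * exp (- u\<^sup>2 / 4)) * normal_density 0 (sqrt 2) x" for x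
  proof (cases "u < \<bar>x\<bar>")
    case True
    then have "u\<^sup>2 \<le> x\<^sup>2" using u by (metis abs_le_square_iff abs_of_nonneg less_imp_le)
    then have "exp (- x\<^sup>2 / 2) \<le> exp (- u\<^sup>2 / 4) * exp (- x\<^sup>2 / 4)"
      by (simp add: exp_add[symmetric])
    then have le: "1 / sqrt (2 * pi) * exp (- x\<^sup>2 / 2) \<le> 1 / sqrt (2 * pi) * (exp (- u\<^sup>2 / 4) * exp (- x\<^sup>2 / 4))"
      by (intro mult_left_mono) auto
    have "sqrt (2 * pi * (sqrt 2)\<^sup>2) = sqrt 2 * sqrt (2 * pi)" by (simp add: real_sqrt_mult)
    then have "sqrt 2 * normal_density 0 (sqrt 2) x = 1 / sqrt (2 * pi) * exp (- x\<^sup>2 / 4)"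
      unfolding normal_density_def by simp
    then have "(sqrt 2 * exp (- u\<^sup>2 / 4)) * normal_density 0 (sqrt 2) x = 1 / sqrt (2 * pi) * (exp (- u\<^sup>2 / 4) * exp (- x\<^sup>2 / 4))"
      by (metis mult.assoc mult.left_commute)
    then show ?thesis using True le by (simp add: normal_density_def)
  qed (simp add: normal_density_nonneg)
  have "emeasure M {\<omega> \<in> space M. u < \<bar>X \<omega>\<bar>} = emeasure M (X -` ?A \<inter> space M)"
    by (rule arg_cong[where f = "emeasure M"]) auto
  also have "\<dots> = (\<integral>\<^sup>+x. ennreal (normal_density 0 1 x) * indicator ?A x \<partial>lborel)"
    by (rule distributed_emeasure[OF X]) measurable
  also have "\<dots> \<le> (\<integral>\<^sup>+x. ennreal ((sqrt 2 * exp (- u\<^sup>2 / 4)) * normal_density 0 (sqrt 2) x) \<partial>lborel)"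
  proof (rule nn_integral_mono)
    fix x :: real
    have "ennreal (normal_density 0 1 x) * indicator ?A x = ennreal (normal_density 0 1 x * indicator ?A x)"
      by (auto simp: indicator_def)
    also have "\<dots> \<le> ennreal ((sqrt 2 * exp (- u\<^sup>2 / 4)) * normal_density 0 (sqrt 2) x)" using pt by (rule ennreal_leI)
    finally show "ennreal (normal_density 0 1 x) * indicator ?A x \<le> ennreal ((sqrt 2 * exp (- u\<^sup>2 / 4)) * normal_density 0 (sqrt 2) x)" .
  qed
  also have "\<dots> = ennreal (\<integral>x. (sqrt 2 * exp (- u\<^sup>2 / 4)) * normal_density 0 (sqrt 2) x \<partial>lborel)"
    by (rule nn_integral_eq_integral) (auto simp: normal_density_nonneg integrable_normal_density)
  also have "\<dots> = ennreal (sqrt 2 * exp (- u\<^sup>2 / 4))" by (simp add: integral_normal_density)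
  finally show ?thesis unfolding measure_def by (simp add: enn2real_leI)
qed

subsection \<open>Pathwise error bound\<close>

context wavelet_system
begin

lemma psi_sqrt_coefficient_bounds:
  assumes "0 < \<beta>1" "0 < S"
  shows "\<exists>K>0. \<forall>\<beta> R f x j k. H_ball \<beta> R f \<longrightarrow> R \<le> R2 \<longrightarrow> \<beta>1 \<le> \<beta> \<longrightarrow> \<beta> < real S \<longrightarrow> x \<in> {0..1} \<longrightarrow>
     -1 \<le> j \<longrightarrow> k \<in> I j \<longrightarrow> \<psi> j k x \<noteq> 0 \<longrightarrow>
     \<bar>LINT t:{0..1}|lborel. \<psi> j k t * sqrt (f t)\<bar> \<le> K * (2 powr - real_of_int j) powr ((\<beta> + 1) / 2) \<and>
     sqrt (f x) * \<bar>LINT t:{0..1}|lborel. \<psi> j k t * sqrt (f t)\<bar> \<le> K * (2 powr - real_of_int j) powr (\<beta> + 1 / 2)"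
proof -
  obtain K where K: "0 < K" and *: "\<And>\<beta> R f x s w. H_ball \<beta> R f \<Longrightarrow> R \<le> R2 \<Longrightarrow> \<beta>1 \<le> \<beta> \<Longrightarrow> \<beta> < real S \<Longrightarrow>
     x \<in> {0..1} \<Longrightarrow> 0 < s \<Longrightarrow> continuous_on {0..1} w \<Longrightarrow> \<forall>t\<in>{0..1}. \<bar>w t\<bar> \<le> c / sqrt s \<Longrightarrow>
     \<forall>t\<in>{0..1}. w t \<noteq> 0 \<longrightarrow> \<bar>t - x\<bar> \<le> 2 * c * s \<Longrightarrow>
     s < 2 \<longrightarrow> (\<forall>m<S. (LINT t:{0..1}|lborel. w t * t ^ m) = 0) \<Longrightarrow>
     \<bar>LINT t:{0..1}|lborel. w t * sqrt (f t)\<bar> \<le> K * s powr ((\<beta> + 1) / 2) \<and>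
     sqrt (f x) * \<bar>LINT t:{0..1}|lborel. w t * sqrt (f t)\<bar> \<le> K * s powr (\<beta> + 1 / 2)"
    using sqrt_coefficient_bounds[OF assms c_pos, of R2] by blast
  show ?thesis
  proof (rule exI[of _ K], intro conjI[OF K] allI impI)
    fix \<beta> R f x j k
    assume a: "H_ball \<beta> R f" "R \<le> R2" "\<beta>1 \<le> \<beta>" "\<beta> < real S" "x \<in> {0..1}"
      and jk: "-1 \<le> j" "k \<in> I j" and nz: "\<psi> j k x \<noteq> 0"
    show "\<bar>LINT t:{0..1}|lborel. \<psi> j k t * sqrt (f t)\<bar> \<le> K * (2 powr - real_of_int j) powr ((\<beta> + 1) / 2) \<and>
     sqrt (f x) * \<bar>LINT t:{0..1}|lborel. \<psi> j k t * sqrt (f t)\<bar> \<le> K * (2 powr - real_of_int j) powr (\<beta> + 1 / 2)"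
    proof (rule *[OF a _ psi_continuous[OF jk]])
      show "0 < (2::real) powr - real_of_int j" by simp
      have "sqrt (2 powr - real_of_int j) = 2 powr - (real_of_int j / 2)"
        by (simp add: powr_half_sqrt[symmetric] powr_powr)
      then have "2 powr (real_of_int j / 2) = 1 / sqrt (2 powr - real_of_int j)"
        by (simp only: powr_minus divide_inverse inverse_inverse_eq mult_1)
      then show "\<forall>t\<in>{0..1}. \<bar>\<psi> j k t\<bar> \<le> c / sqrt (2 powr - real_of_int j)"
        using psi_bound[OF jk] by simp
      show "\<forall>t\<in>{0..1}. \<psi> j k t \<noteq> 0 \<longrightarrow> \<bar>t - x\<bar> \<le> 2 * c * 2 powr - real_of_int j"
        using psi_support[OF jk a(5) nz] by blast
      \<comment> \<open>For \<open>j \<ge> -1\<close>, the condition \<open>s < 2\<close> separates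
        the wavelets, which have vanishing moments, from the scaling functions, where
        \<open>s = 2\<close>.\<close>
      have "0 \<le> j" if "2 powr - real_of_int j < (2::real)"
      proof (rule ccontr)
        assume "\<not> 0 \<le> j"
        then have "j = -1" using jk by linarith
        then show False using that by simp
      qed
      then show "2 powr - real_of_int j < (2::real) \<longrightarrow> (\<forall>m<S. (LINT t:{0..1}|lborel. \<psi> j k t * t ^ m) = 0)"
        using moments jk(2) by blast
    qed
  qed
qed

text \<open>At most \<open>c\<close> functions of a level are nonzero at \<open>x\<close>. The bound
  on \<open>a\<close> is asked only for those, because the coefficient bounds in terms of
  \<open>f x\<close> hold only for wavelets that do not vanish at \<open>x\<close>.\<close>

lemma level_sum_bound:
  assumes j: "-1 \<le> j" and x: "x \<in> {0..1}" and B: "\<And>k. k \<in> I j \<Longrightarrow> \<psi> j k x \<noteq> 0 \<Longrightarrow> \<bar>a k\<bar> \<le> B"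
    and B0: "0 \<le> B"
  shows "\<bar>\<Sum>k\<in>I j. a k * \<psi> j k x\<bar> \<le> c\<^sup>2 * 2 powr (real_of_int j / 2) * B"
proof -
  let ?N = "{k \<in> I j. \<psi> j k x \<noteq> 0}"
  have "(\<Sum>k\<in>I j. a k * \<psi> j k x) = (\<Sum>k\<in>?N. a k * \<psi> j k x)"
    using finite_index[OF j] by (intro sum.mono_neutral_right) auto
  also have "\<bar>\<dots>\<bar> \<le> (\<Sum>k\<in>?N. B * (c * 2 powr (real_of_int j / 2)))"
  proof (rule order_trans[OF sum_abs sum_mono])
    fix k assume "k \<in> ?N"
    then show "\<bar>a k * \<psi> j k x\<bar> \<le> B * (c * 2 powr (real_of_int j / 2))"
      unfolding abs_mult using B psi_bound[OF j _ x] B0 by (intro mult_mono) auto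
  qed
  also have "\<dots> = real (card ?N) * (B * (c * 2 powr (real_of_int j / 2)))" by simp
  also have "\<dots> \<le> c * (B * (c * 2 powr (real_of_int j / 2)))"
    using overlap[OF j x] B0 c_pos by (intro mult_right_mono) auto
  finally show ?thesis by (simp add: power2_eq_square mult_ac)
qed

text \<open>The alternative \<open>n \<le> N0\<close> covers the finitely many sample sizes for which the noise may exceed the
  threshold; there \<open>2 powr - j\<close> is bounded below, so the second bound holds up to a constant.\<close>

lemma coefficient_errors_imp_pathwise_rate:
  fixes \<beta>1 R2 K1 N0 :: real
  assumes \<beta>1: "0 < \<beta>1" and S: "0 < S" and K1: "0 \<le> K1" and N0: "1 \<le> N0"
  shows "\<exists>C. \<forall>n J \<beta> R f y. 2 \<le> n \<longrightarrow> real n / 2 \<le> 2 ^ J \<longrightarrow> 2 ^ J \<le> real n \<longrightarrow>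
     \<beta>1 \<le> \<beta> \<longrightarrow> \<beta> < real S \<longrightarrow> R \<le> R2 \<longrightarrow> H_ball \<beta> R f \<longrightarrow>
     (\<forall>j\<in>{-1..int J}. \<forall>k\<in>I j.
        \<bar>y j k - 2 * (LINT t:{0..1}|lborel. \<psi> j k t * sqrt (f t))\<bar> \<le> K1 * sqrt (ln (real n) / real n) \<and>
        (\<bar>y j k - 2 * (LINT t:{0..1}|lborel. \<psi> j k t * sqrt (f t))\<bar> \<le> K1 * \<bar>LINT t:{0..1}|lborel. \<psi> j k t * sqrt (f t)\<bar>
          \<or> real n \<le> N0)) \<longrightarrow>
     (\<forall>x\<in>{0..1}. \<bar>(\<Sum>j\<in>{-1..int J}. \<Sum>k\<in>I j. y j k * \<psi> j k x)\<^sup>2 / 4 - f x\<bar> \<le> C * rtilde n \<beta> (f x))"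
proof -
  define R' where "R' = max 1 R2"
  have R': "1 \<le> R'" "R2 \<le> R'" by (auto simp: R'_def)
  obtain K0 where K0: "0 < K0" and coef: "\<And>\<beta> R f x j k. H_ball \<beta> R f \<Longrightarrow> R \<le> R2 \<Longrightarrow> \<beta>1 \<le> \<beta> \<Longrightarrow> \<beta> < real S \<Longrightarrow> x \<in> {0..1} \<Longrightarrow>
     -1 \<le> j \<Longrightarrow> k \<in> I j \<Longrightarrow> \<psi> j k x \<noteq> 0 \<Longrightarrow>
     \<bar>LINT t:{0..1}|lborel. \<psi> j k t * sqrt (f t)\<bar> \<le> K0 * (2 powr - real_of_int j) powr ((\<beta> + 1) / 2) \<and>
     sqrt (f x) * \<bar>LINT t:{0..1}|lborel. \<psi> j k t * sqrt (f t)\<bar> \<le> K0 * (2 powr - real_of_int j) powr (\<beta> + 1 / 2)"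
    using psi_sqrt_coefficient_bounds[OF \<beta>1 S, of R2] by blast
  \<comment> \<open>The summands serve three cases: \<open>2 * K0\<close> for levels above
    \<open>J\<close>, where the whole coefficient is lost; \<open>K1 * K0\<close> for errors
    proportional to the coefficient; the last one for \<open>n \<le> N0\<close>.\<close>
  define K2 where "K2 = (2 + K1) * K0 + sqrt R' * K1 * N0 powr (real S + 1)"
  have K2: "0 \<le> K2" "2 * K0 \<le> K2" "K1 * K0 \<le> K2" "sqrt R' * K1 * N0 powr (real S + 1) \<le> K2" "K1 * N0 powr (real S + 1) \<le> K2"
  proof -
    have "0 \<le> sqrt R' * K1 * N0 powr (real S + 1)" "0 \<le> K1 * K0" using R' K1 K0 by simp_all
    then show "0 \<le> K2" "2 * K0 \<le> K2" "K1 * K0 \<le> K2" and *: "sqrt R' * K1 * N0 powr (real S + 1) \<le> K2"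
      using K0 unfolding K2_def by (simp_all add: algebra_simps)
    have "1 * (K1 * N0 powr (real S + 1)) \<le> sqrt R' * (K1 * N0 powr (real S + 1))"
      using R' K1 by (intro mult_right_mono) auto
    then show "K1 * N0 powr (real S + 1) \<le> K2" using * by (simp add: mult.assoc)
  qed
  \<comment> \<open>One constant for both kinds of error bound; \<open>2 powr S\<close> pays for the
    shift between the index \<open>i\<close> and the level \<open>i - 1\<close>.\<close>
  define K3 where "K3 = c\<^sup>2 * (K1 + K2) * 2 powr real S"
  have two1: "1 \<le> 2 powr real S" by (rule ge_one_powr_ge_zero) auto
  have K3: "0 \<le> K3" "c\<^sup>2 * K1 \<le> K3" "c\<^sup>2 * K2 * 2 powr real S \<le> K3"
  proof -
    show "0 \<le> K3" "c\<^sup>2 * K2 * 2 powr real S \<le> K3" using K1 K2 by (auto simp: K3_def algebra_simps)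
    have "c\<^sup>2 * K1 * 1 \<le> c\<^sup>2 * (K1 + K2) * 2 powr real S"
      using K1 K2 two1 by (intro mult_mono) auto
    then show "c\<^sup>2 * K1 \<le> K3" by (simp add: K3_def)
  qed
  define B1 where "B1 = K3 * (4 + 1 / (1 - 2 powr - (\<beta>1 / 2)))"
  define B2 where "B2 = K3 * (4 + 1 / (1 - 2 powr - \<beta>1))"
  have B0: "0 \<le> B1" "0 \<le> B2"
    using K3(1) \<beta>1 unfolding B1_def B2_def
    by (auto intro!: mult_nonneg_nonneg add_nonneg_nonneg simp: powr_le_one_le less_imp_le[OF powr_less_one])
  have main: "\<bar>(\<Sum>j\<in>{-1..int J}. \<Sum>k\<in>I j. y j k * \<psi> j k x)\<^sup>2 / 4 - f x\<bar> \<le> (B1\<^sup>2 / 4 + B1 + B2) * rtilde n \<beta> (f x)"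
    if n: "2 \<le> n" "real n / 2 \<le> 2 ^ J" "2 ^ J \<le> real n"
      and \<beta>: "\<beta>1 \<le> \<beta>" "\<beta> < real S" and H: "R \<le> R2" "H_ball \<beta> R f"
      and y: "\<And>j k. -1 \<le> j \<Longrightarrow> j \<le> int J \<Longrightarrow> k \<in> I j \<Longrightarrow>
        \<bar>y j k - 2 * (LINT t:{0..1}|lborel. \<psi> j k t * sqrt (f t))\<bar> \<le> K1 * sqrt (ln (real n) / real n) \<and>
        (\<bar>y j k - 2 * (LINT t:{0..1}|lborel. \<psi> j k t * sqrt (f t))\<bar> \<le> K1 * \<bar>LINT t:{0..1}|lborel. \<psi> j k t * sqrt (f t)\<bar>
          \<or> real n \<le> N0)"
      and x: "x \<in> {0..1}" for n J \<beta> R f y x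
  proof -
    have b0: "0 < \<beta>" using \<beta> \<beta>1 by linarith
    define v where "v = ln (real n) / real n"
    define \<delta> where "\<delta> = sqrt v"
    have ln_half: "1 / 2 \<le> ln (real n)"
    proof -
      have "1 / 2 \<le> ln (2::real)" using ln2_ge_two_thirds by linarith
      also have "\<dots> \<le> ln (real n)" using n(1) by simp
      finally show ?thesis .
    qed
    have v: "0 < v" "v \<le> 1" "1 / (2 * real n) \<le> v"
    proof -
      show "0 < v" using n(1) by (simp add: v_def)
      show "v \<le> 1" using n(1) ln_le_minus_one[of "real n"] by (simp add: v_def)
      show "1 / (2 * real n) \<le> v" using ln_half n(1) by (simp add: v_def field_simps)
    qed
    have \<delta>: "0 < \<delta>" "\<delta> \<le> 1" using v by (auto simp: \<delta>_def)
    define \<theta> where "\<theta> j k = (LINT t:{0..1}|lborel. \<psi> j k t * sqrt (f t))" for j k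
    \<comment> \<open>Extension by zero beyond level \<open>J\<close> turns the truncation bias into
      a coefficient error \<open>2 * \<theta>\<close>, treated like all others.\<close>
    define yy where "yy j k = (if j \<le> int J then y j k else 0)" for j k
    define F where "F = sqrt (f x)"
    have fx: "0 \<le> f x" using H_ball_nonneg[OF H(2) x] .
    have F0: "0 \<le> F" using fx by (simp add: F_def)
    have fR: "f x \<le> R'" using H_ballE[OF H(2) _ b0, of R'] H(1) R'(2) x by (meson order_trans)
    have FR: "F \<le> sqrt R'" using fR by (simp add: F_def)
    let ?s = "\<lambda>j. 2 powr - real_of_int j"
    have err1: "\<bar>yy j k - 2 * \<theta> j k\<bar> \<le> K1 * \<delta>" if "-1 \<le> j" "j \<le> int J" "k \<in> I j" for j k
      using y[OF that] that by (simp add: yy_def \<theta>_def \<delta>_def v_def)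
    have err2: "\<bar>yy j k - 2 * \<theta> j k\<bar> \<le> K2 * ?s j powr ((\<beta> + 1) / 2) \<and>
        F * \<bar>yy j k - 2 * \<theta> j k\<bar> \<le> K2 * ?s j powr (\<beta> + 1 / 2)"
      if j: "-1 \<le> j" and k: "k \<in> I j" and nz: "\<psi> j k x \<noteq> 0" for j k
    proof -
      have cf: "\<bar>\<theta> j k\<bar> \<le> K0 * ?s j powr ((\<beta> + 1) / 2)" "F * \<bar>\<theta> j k\<bar> \<le> K0 * ?s j powr (\<beta> + 1 / 2)"
        using coef[OF H(2,1) \<beta> x j k nz] by (auto simp: \<theta>_def F_def)
      have rel: ?thesis if e: "\<bar>yy j k - 2 * \<theta> j k\<bar> \<le> K' * \<bar>\<theta> j k\<bar>" and K': "0 \<le> K'" "K' * K0 \<le> K2" for K'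
      proof
        have "\<bar>yy j k - 2 * \<theta> j k\<bar> \<le> K' * (K0 * ?s j powr ((\<beta> + 1) / 2))"
          using e mult_left_mono[OF cf(1) K'(1)] by linarith
        also have "\<dots> \<le> K2 * ?s j powr ((\<beta> + 1) / 2)"
          unfolding mult.assoc[symmetric] using K' by (intro mult_right_mono) auto
        finally show "\<bar>yy j k - 2 * \<theta> j k\<bar> \<le> K2 * ?s j powr ((\<beta> + 1) / 2)" .
        have "F * \<bar>yy j k - 2 * \<theta> j k\<bar> \<le> F * (K' * \<bar>\<theta> j k\<bar>)" using e F0 by (rule mult_left_mono)
        also have "\<dots> = K' * (F * \<bar>\<theta> j k\<bar>)" by simp
        also have "\<dots> \<le> K' * (K0 * ?s j powr (\<beta> + 1 / 2))" using cf(2) K'(1) by (rule mult_left_mono)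
        also have "\<dots> \<le> K2 * ?s j powr (\<beta> + 1 / 2)"
          unfolding mult.assoc[symmetric] using K' by (intro mult_right_mono) auto
        finally show "F * \<bar>yy j k - 2 * \<theta> j k\<bar> \<le> K2 * ?s j powr (\<beta> + 1 / 2)" .
      qed
      consider "int J < j" | "j \<le> int J" "\<bar>y j k - 2 * \<theta> j k\<bar> \<le> K1 * \<bar>\<theta> j k\<bar>" | "j \<le> int J" "real n \<le> N0"
        using y[OF j _ k] unfolding \<theta>_def by fastforce
      then show ?thesis
      proof cases
        case 1
        then show ?thesis using K2 by (intro rel[of 2]) (auto simp: yy_def)
      next
        case 2
        then show ?thesis using K2 K1 by (intro rel[of K1]) (auto simp: yy_def)
      next
        case 3
        have e: "\<bar>yy j k - 2 * \<theta> j k\<bar> \<le> K1"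
          using err1[OF j 3(1) k] mult_left_mono[OF \<delta>(2) K1] by linarith
        have sp: "1 \<le> N0 powr (real S + 1) * ?s j powr p" if p: "0 \<le> p" "p \<le> real S + 1" for p
        proof -
          have "2 powr real_of_int j \<le> 2 powr real J" using 3(1) by (intro powr_mono) auto
          also have "\<dots> = 2 ^ J" by (simp add: powr_realpow)
          also have "\<dots> \<le> N0" by (rule order_trans[OF n(3) 3(2)])
          finally have "(2 powr real_of_int j) powr p \<le> N0 powr p" using p by (intro powr_mono2) auto
          also have "\<dots> \<le> N0 powr (real S + 1)" using N0 p by (intro powr_mono) auto
          finally have "(2 powr real_of_int j) powr p * ?s j powr p \<le> N0 powr (real S + 1) * ?s j powr p"
            by (intro mult_right_mono) auto
          moreover have "(2 powr real_of_int j) powr p * ?s j powr p = 1"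
            by (simp add: powr_powr powr_add[symmetric])
          ultimately show ?thesis by simp
        qed
        show ?thesis
        proof
          have "K1 * 1 \<le> K1 * (N0 powr (real S + 1) * ?s j powr ((\<beta> + 1) / 2))"
            using K1 sp[of "(\<beta> + 1) / 2"] b0 \<beta>(2) by (intro mult_left_mono) auto
          also have "\<dots> \<le> K2 * ?s j powr ((\<beta> + 1) / 2)"
            unfolding mult.assoc[symmetric] using K2(5) by (intro mult_right_mono) auto
          finally show "\<bar>yy j k - 2 * \<theta> j k\<bar> \<le> K2 * ?s j powr ((\<beta> + 1) / 2)" using e by linarith
          have "F * \<bar>yy j k - 2 * \<theta> j k\<bar> \<le> sqrt R' * K1"
            using FR e F0 K1 R' by (intro mult_mono) auto
          also have "\<dots> = (sqrt R' * K1) * 1" by simp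
          also have "\<dots> \<le> (sqrt R' * K1) * (N0 powr (real S + 1) * ?s j powr (\<beta> + 1 / 2))"
            using K1 R' sp[of "\<beta> + 1 / 2"] b0 \<beta>(2) by (intro mult_left_mono) auto
          also have "\<dots> \<le> K2 * ?s j powr (\<beta> + 1 / 2)"
            unfolding mult.assoc[symmetric] using K2(4) by (intro mult_right_mono) auto
          finally show "F * \<bar>yy j k - 2 * \<theta> j k\<bar> \<le> K2 * ?s j powr (\<beta> + 1 / 2)" .
        qed
      qed
    qed
    have ji: "-1 \<le> int i - 1" for i by simp
    have lev: "2 powr (real_of_int (int i - 1) / 2) \<le> 2 powr (real i / 2)" for i by simp
    have lev1: "2 powr (real_of_int (int i - 1) / 2) * ?s (int i - 1) powr ((\<beta> + 1) / 2) \<le> 2 powr real S * 2 powr (- (\<beta> / 2 * real i))" for i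
    proof -
      have "2 powr (real_of_int (int i - 1) / 2) * ?s (int i - 1) powr ((\<beta> + 1) / 2) =
          2 powr (real_of_int (int i - 1) / 2 + - real_of_int (int i - 1) * ((\<beta> + 1) / 2))"
        unfolding powr_powr by (rule powr_add[symmetric])
      also have "real_of_int (int i - 1) / 2 + - real_of_int (int i - 1) * ((\<beta> + 1) / 2) = \<beta> / 2 - \<beta> / 2 * real i" by (simp add: algebra_simps add_divide_distrib diff_divide_distrib)
      also have "2 powr (\<beta> / 2 - \<beta> / 2 * real i) \<le> 2 powr (real S - \<beta> / 2 * real i)" using \<beta>(2) b0 by simp
      finally show ?thesis by (simp only: diff_conv_add_uminus powr_add)
    qed
    have lev2: "2 powr (real_of_int (int i - 1) / 2) * ?s (int i - 1) powr (\<beta> + 1 / 2) \<le> 2 powr real S * 2 powr (- (\<beta> * real i))" for i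
    proof -
      have "2 powr (real_of_int (int i - 1) / 2) * ?s (int i - 1) powr (\<beta> + 1 / 2) =
          2 powr (real_of_int (int i - 1) / 2 + - real_of_int (int i - 1) * (\<beta> + 1 / 2))"
        unfolding powr_powr by (rule powr_add[symmetric])
      also have "real_of_int (int i - 1) / 2 + - real_of_int (int i - 1) * (\<beta> + 1 / 2) = \<beta> - \<beta> * real i" by (simp add: algebra_simps add_divide_distrib diff_divide_distrib)
      also have "2 powr (\<beta> - \<beta> * real i) \<le> 2 powr (real S - \<beta> * real i)" using \<beta>(2) by simp
      finally show ?thesis by (simp only: diff_conv_add_uminus powr_add)
    qed
    define e where "e i = \<bar>\<Sum>k\<in>I (int i - 1). (yy (int i - 1) k - 2 * \<theta> (int i - 1) k) * \<psi> (int i - 1) k x\<bar>" for i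
    have eA: "e i \<le> K3 * (\<delta> * 2 powr (real i / 2))" if "i \<le> J + 1" for i
    proof -
      have "e i \<le> c\<^sup>2 * 2 powr (real_of_int (int i - 1) / 2) * (K1 * \<delta>)"
        unfolding e_def using that \<delta> K1 by (intro level_sum_bound[OF ji x] err1) auto
      also have "\<dots> \<le> c\<^sup>2 * 2 powr (real i / 2) * (K1 * \<delta>)"
        using lev \<delta> K1 by (intro mult_right_mono mult_left_mono) auto
      also have "\<dots> = (c\<^sup>2 * K1) * (\<delta> * 2 powr (real i / 2))" by simp
      also have "\<dots> \<le> K3 * (\<delta> * 2 powr (real i / 2))" using K3(2) \<delta> by (intro mult_right_mono) auto
      finally show ?thesis .
    qed
    have eB: "e i \<le> K3 * 2 powr (- (\<beta> / 2 * real i))" for i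
    proof -
      have "e i \<le> c\<^sup>2 * 2 powr (real_of_int (int i - 1) / 2) * (K2 * ?s (int i - 1) powr ((\<beta> + 1) / 2))"
        unfolding e_def by (intro level_sum_bound[OF ji x]) (use err2[OF ji] K2(1) in auto)
      also have "\<dots> = (c\<^sup>2 * K2) * (2 powr (real_of_int (int i - 1) / 2) * ?s (int i - 1) powr ((\<beta> + 1) / 2))" by simp
      also have "\<dots> \<le> (c\<^sup>2 * K2) * (2 powr real S * 2 powr (- (\<beta> / 2 * real i)))"
        using lev1 K2(1) by (intro mult_left_mono) auto
      also have "\<dots> \<le> K3 * 2 powr (- (\<beta> / 2 * real i))"
        unfolding mult.assoc[symmetric] using K3(3) by (intro mult_right_mono) auto
      finally show ?thesis .
    qed
    have eC: "F * e i \<le> K3 * 2 powr (- (\<beta> * real i))" for i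
    proof -
      have "F * e i = \<bar>\<Sum>k\<in>I (int i - 1). (F * (yy (int i - 1) k - 2 * \<theta> (int i - 1) k)) * \<psi> (int i - 1) k x\<bar>"
        unfolding e_def using F0 by (simp add: abs_mult_pos' sum_distrib_left mult.assoc)
      also have "\<dots> \<le> c\<^sup>2 * 2 powr (real_of_int (int i - 1) / 2) * (K2 * ?s (int i - 1) powr (\<beta> + 1 / 2))"
        by (intro level_sum_bound[OF ji x]) (use err2[OF ji] K2(1) F0 in \<open>auto simp: abs_mult\<close>)
      also have "\<dots> = (c\<^sup>2 * K2) * (2 powr (real_of_int (int i - 1) / 2) * ?s (int i - 1) powr (\<beta> + 1 / 2))" by simp
      also have "\<dots> \<le> (c\<^sup>2 * K2) * (2 powr real S * 2 powr (- (\<beta> * real i)))"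
        using lev2 K2(1) by (intro mult_left_mono) auto
      also have "\<dots> \<le> K3 * 2 powr (- (\<beta> * real i))"
        unfolding mult.assoc[symmetric] using K3(3) by (intro mult_right_mono) auto
      finally show ?thesis .
    qed
    \<comment> \<open>Both summations over scales cross at or below this level: it is at most
      \<open>1 / v \<le> 2 * n\<close>, and \<open>n \<le> 2 * 2 ^ J\<close>.\<close>
    have T1: "v powr (- 1 / (\<beta> + 1)) \<le> 2 ^ (J + 2)"
    proof -
      have "v powr (- 1 / (\<beta> + 1)) \<le> v powr (- 1)" using v b0 by (intro powr_mono') (auto simp: field_simps)
      also have "\<dots> = 1 / v" using v by (simp add: powr_minus_divide)
      also have "\<dots> \<le> 2 * real n" using v n(1) by (simp add: field_simps)
      also have "\<dots> \<le> 2 ^ (J + 2)" using n(2) by simp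
      finally show ?thesis .
    qed
    define hh where "hh = (\<Sum>j\<in>{-1..int J}. \<Sum>k\<in>I j. y j k * \<psi> j k x)"
    define E where "E = \<bar>hh - 2 * F\<bar>"
    \<comment> \<open>Pointwise convergence of the expansion of \<open>sqrt f\<close> reduces
      \<open>E\<close> to partial sums of level errors, once \<open>L \<ge> J + 2\<close> covers all
      levels of the estimator.\<close>
    have Ele: "E \<le> B" if B: "\<And>L. (\<Sum>i<L. e i) \<le> B" for B
    proof -
      define P where "P i = (\<Sum>k\<in>I (int i - 1). \<theta> (int i - 1) k * \<psi> (int i - 1) k x)" for i
      have "P sums F"
        unfolding P_def \<theta>_def F_def
      proof (rule wavelet_expansion[OF _ _ _ x])
        show "continuous_on {0..1} (\<lambda>t. sqrt (f t))"
          using H_ball_continuous_on[OF H(2) b0] by (intro continuous_intros)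
        define z where "z = 2 powr - (\<beta> / 2)"
        have z: "0 < z" "z < 1" using b0 by (auto simp: z_def powr_less_one)
        show "summable (\<lambda>i. (c\<^sup>2 * K0 * 2 powr real S) * z ^ i)"
          using z by (intro summable_mult summable_geometric) auto
        fix i and u :: real assume u: "u \<in> {0..1}"
        have zi: "2 powr (- (\<beta> / 2 * real i)) = z ^ i" by (simp add: z_def powr_powr powr_realpow[symmetric])
        have "\<bar>\<Sum>k\<in>I (int i - 1). (LINT t:{0..1}|lborel. \<psi> (int i - 1) k t * sqrt (f t)) * \<psi> (int i - 1) k u\<bar>
           \<le> c\<^sup>2 * 2 powr (real_of_int (int i - 1) / 2) * (K0 * ?s (int i - 1) powr ((\<beta> + 1) / 2))"
          by (intro level_sum_bound[OF ji u]) (use coef[OF H(2,1) \<beta> u ji] K0 in auto)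
        also have "\<dots> = (c\<^sup>2 * K0) * (2 powr (real_of_int (int i - 1) / 2) * ?s (int i - 1) powr ((\<beta> + 1) / 2))" by simp
        also have "\<dots> \<le> (c\<^sup>2 * K0) * (2 powr real S * 2 powr (- (\<beta> / 2 * real i)))"
          using lev1 K0 by (intro mult_left_mono) auto
        finally show "\<bar>\<Sum>k\<in>I (int i - 1). (LINT t:{0..1}|lborel. \<psi> (int i - 1) k t * sqrt (f t)) * \<psi> (int i - 1) k u\<bar>
           \<le> (c\<^sup>2 * K0 * 2 powr real S) * z ^ i" unfolding zi by (simp only: mult.assoc)
      qed
      then have lim: "(\<lambda>L. \<bar>hh - 2 * (\<Sum>i<L. P i)\<bar>) \<longlonglongrightarrow> E"
        unfolding sums_def E_def by (intro tendsto_intros)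
      have "\<bar>hh - 2 * (\<Sum>i<L. P i)\<bar> \<le> B" if L: "J + 2 \<le> L" for L
      proof -
        have "hh = (\<Sum>i<J + 2. \<Sum>k\<in>I (int i - 1). y (int i - 1) k * \<psi> (int i - 1) k x)"
          unfolding hh_def
          by (rule sum.reindex_bij_witness[where i = "\<lambda>i. int i - 1" and j = "\<lambda>j. nat (j + 1)"]) auto
        also have "\<dots> = (\<Sum>i<J + 2. \<Sum>k\<in>I (int i - 1). yy (int i - 1) k * \<psi> (int i - 1) k x)"
          by (intro sum.cong) (auto simp: yy_def)
        also have "\<dots> = (\<Sum>i<L. \<Sum>k\<in>I (int i - 1). yy (int i - 1) k * \<psi> (int i - 1) k x)"
          using L by (intro sum.mono_neutral_left) (auto simp: yy_def)
        finally have "hh - 2 * (\<Sum>i<L. P i) =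
            (\<Sum>i<L. \<Sum>k\<in>I (int i - 1). (yy (int i - 1) k - 2 * \<theta> (int i - 1) k) * \<psi> (int i - 1) k x)"
          by (simp add: P_def sum_distrib_left sum_subtractf left_diff_distrib mult.assoc)
        then have "\<bar>hh - 2 * (\<Sum>i<L. P i)\<bar> \<le> (\<Sum>i<L. e i)" unfolding e_def by (simp add: sum_abs)
        then show ?thesis using B[of L] by linarith
      qed
      then show ?thesis by (intro LIMSEQ_le_const2[OF lim]) blast
    qed
    define r1 where "r1 = v powr (\<beta> / (\<beta> + 1))"
    have r1: "0 < r1" using v by (simp add: r1_def)
    have sr1: "\<delta> powr (\<beta> / (\<beta> + 1)) = sqrt r1"
      using v by (simp add: \<delta>_def r1_def powr_half_sqrt[symmetric] powr_powr mult.commute)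
    have E1: "E \<le> B1 * sqrt r1"
    proof (rule Ele)
      fix L
      have "(\<Sum>i<L. e i) \<le> K3 * (4 + 1 / (1 - 2 powr - (\<beta>1 / 2))) * \<delta> powr (2 * (\<beta> / 2) / (2 * (\<beta> / 2) + 1))"
      proof (rule sum_min_geometric_le[OF _ _ \<delta>(1) K3(1) eA eB])
        have "\<delta> powr (- 2 / (2 * (\<beta> / 2) + 1)) = v powr (- 1 / (\<beta> + 1))"
          using v by (simp add: \<delta>_def powr_half_sqrt[symmetric] powr_powr)
        then show "\<delta> powr (- 2 / (2 * (\<beta> / 2) + 1)) \<le> 2 ^ (J + 2)" using T1 by simp
      qed (use \<beta>1 \<beta> in auto)
      then show "(\<Sum>i<L. e i) \<le> B1 * sqrt r1" by (simp add: B1_def sr1)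
    qed
    have rt: "r1 \<le> rtilde n \<beta> (f x)" "(f x * v) powr (\<beta> / (2 * \<beta> + 1)) \<le> rtilde n \<beta> (f x)"
      by (auto simp: rtilde_def r1_def v_def)
    \<comment> \<open>If \<open>f x \<le> r1\<close>, then \<open>F \<le> sqrt r1\<close> and the
      first branch suffices. Otherwise the weighted sum is used, with noise
      \<open>F * \<delta>\<close> and smoothness \<beta>.\<close>
    have FE: "F * E \<le> (B1 + B2) * rtilde n \<beta> (f x)"
    proof (cases "f x \<le> r1")
      case True
      then have "F \<le> sqrt r1" by (simp add: F_def)
      then have "F * E \<le> sqrt r1 * (B1 * sqrt r1)" using E1 r1 by (intro mult_mono) (auto simp: E_def)
      also have "\<dots> = B1 * r1" using r1 by simp
      also have "\<dots> \<le> (B1 + B2) * rtilde n \<beta> (f x)" using B0 rt(1) r1 by (intro mult_mono) auto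
      finally show ?thesis .
    next
      case False
      have f0: "0 < f x" using False r1 by linarith
      then have Fp: "0 < F" by (simp add: F_def)
      have Fd: "F * \<delta> = (f x * v) powr (1 / 2)" using f0 v by (simp add: F_def \<delta>_def powr_half_sqrt real_sqrt_mult)
      have "E \<le> B2 * (f x * v) powr (\<beta> / (2 * \<beta> + 1)) / F"
      proof (rule Ele)
        fix L
        have "(\<Sum>i<L. F * e i) \<le> K3 * (4 + 1 / (1 - 2 powr - \<beta>1)) * (F * \<delta>) powr (2 * \<beta> / (2 * \<beta> + 1))"
        proof (rule sum_min_geometric_le[OF \<beta>1 \<beta>(1) _ K3(1) _ eC])
          show "0 < F * \<delta>" using Fp \<delta> by simp
          show "F * e i \<le> K3 * (F * \<delta> * 2 powr (real i / 2))" if "i \<le> J + 1" for i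
            using mult_left_mono[OF eA[OF that] F0] by (simp add: mult_ac)
          \<comment> \<open>At \<open>f x = r1\<close> the two crossing levels coincide; for larger
            \<open>f x\<close> the weighted one is lower, so \<open>T1\<close> still covers
            it.\<close>
          have "v powr ((2 * \<beta> + 1) / (\<beta> + 1)) = r1 * v"
          proof -
            have "(2 * \<beta> + 1) / (\<beta> + 1) = \<beta> / (\<beta> + 1) + 1" using b0 by (simp add: field_simps)
            then show ?thesis using v by (simp add: r1_def powr_add)
          qed
          also have "\<dots> \<le> f x * v" using False v by (intro mult_right_mono) auto
          finally have "(f x * v) powr (- 1 / (2 * \<beta> + 1)) \<le> (v powr ((2 * \<beta> + 1) / (\<beta> + 1))) powr (- 1 / (2 * \<beta> + 1))"
            using v b0 by (intro powr_mono2') auto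
          also have "\<dots> = v powr (- 1 / (\<beta> + 1))" using b0 by (simp add: powr_powr)
          finally show "(F * \<delta>) powr (- 2 / (2 * \<beta> + 1)) \<le> 2 ^ (J + 2)"
            using T1 unfolding Fd powr_powr by simp
        qed
        then have "F * (\<Sum>i<L. e i) \<le> B2 * (f x * v) powr (\<beta> / (2 * \<beta> + 1))"
          unfolding B2_def Fd powr_powr by (simp add: sum_distrib_left)
        then show "(\<Sum>i<L. e i) \<le> B2 * (f x * v) powr (\<beta> / (2 * \<beta> + 1)) / F"
          using Fp by (simp add: pos_le_divide_eq mult.commute)
      qed
      then have "F * E \<le> B2 * (f x * v) powr (\<beta> / (2 * \<beta> + 1))" using Fp by (simp add: pos_le_divide_eq mult.commute)
      also have "\<dots> \<le> (B1 + B2) * rtilde n \<beta> (f x)" using B0 rt(2) by (intro mult_mono) auto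
      finally show ?thesis .
    qed
    have EE: "E\<^sup>2 \<le> B1\<^sup>2 * rtilde n \<beta> (f x)"
    proof -
      have "E\<^sup>2 \<le> (B1 * sqrt r1)\<^sup>2" using E1 by (intro power_mono) (auto simp: E_def)
      also have "\<dots> = B1\<^sup>2 * r1" using r1 by (simp add: power_mult_distrib)
      also have "\<dots> \<le> B1\<^sup>2 * rtilde n \<beta> (f x)" using rt(1) by (intro mult_left_mono) auto
      finally show ?thesis .
    qed
    have "hh\<^sup>2 / 4 - f x = (hh - 2 * F) * (hh - 2 * F + 4 * F) / 4"
      using fx by (simp add: F_def algebra_simps power2_eq_square)
    then have "\<bar>hh\<^sup>2 / 4 - f x\<bar> = E * \<bar>hh - 2 * F + 4 * F\<bar> / 4" by (simp only: E_def abs_mult abs_divide abs_numeral)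
    also have "\<dots> \<le> E * (E + 4 * F) / 4"
      using F0 by (intro divide_right_mono mult_left_mono) (auto simp: E_def)
    also have "\<dots> = E\<^sup>2 / 4 + F * E" by (simp add: power2_eq_square algebra_simps add_divide_distrib)
    also have "\<dots> \<le> (B1\<^sup>2 / 4 + B1 + B2) * rtilde n \<beta> (f x)" using EE FE by (simp add: algebra_simps)
    finally show ?thesis unfolding hh_def .
  qed
  show ?thesis
    by (rule exI[of _ "B1\<^sup>2 / 4 + B1 + B2"], intro allI impI ballI) (rule main; simp)
qed

end

subsection \<open>Noise\<close>

text \<open>A killed coefficient costs \<open>\<bar>\<theta>\<bar>\<close>. A surviving one has
  \<open>\<bar>\<theta>\<bar> > \<tau> * \<delta> - \<bar>z\<bar> \<ge> \<tau> * \<delta> / 4 \<ge>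
  \<bar>z\<bar> / 3\<close>, so its error \<open>\<bar>z\<bar>\<close> is at most
  \<open>3 * \<bar>\<theta>\<bar>\<close>.\<close>

lemma thresholded_coefficient_error:
  fixes \<theta> z \<delta> \<tau> :: real
  defines "err \<equiv> \<bar>(\<theta> + z) * (if \<bar>\<theta> + z\<bar> > \<tau> * \<delta> then 1 else 0) - \<theta>\<bar>"
  shows "err \<le> \<bar>z\<bar> + \<bar>\<tau> * \<delta>\<bar>"
    and "\<bar>z\<bar> \<le> 3 / 4 * (\<tau> * \<delta>) \<Longrightarrow> err \<le> 3 * \<bar>\<theta>\<bar>"
  unfolding err_def by (auto simp: abs_if split: if_splits)

text \<open>A union bound: each \<open>W (\<psi> j k)\<close> is standard normal because
  \<open>\<psi> j k\<close> has norm 1, and the levels up to \<open>J\<close> contain at most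
  \<open>2 * c * n\<close> coefficients.\<close>

lemma (in wavelet_system) noise_event:
  assumes M: "prob_space M" and W: "isonormal M W" and u: "0 \<le> u" and J: "2 ^ J \<le> real n"
  defines "A \<equiv> {\<omega> \<in> space M. \<forall>j\<in>{-1..int J}. \<forall>k\<in>I j. \<bar>W (\<psi> j k) \<omega>\<bar> \<le> u}"
  shows "A \<in> sets M" "1 - 2 * c * real n * (sqrt 2 * exp (- u\<^sup>2 / 4)) \<le> measure M A"
proof -
  interpret prob_space M by (rule M)
  define P where "P = Sigma {-1..int J} I"
  have finP: "finite P" unfolding P_def using finite_index by (intro finite_SigmaI) auto
  define B where "B jk = {\<omega> \<in> space M. u < \<bar>W (\<psi> (fst jk) (snd jk)) \<omega>\<bar>}" for jk
  have meas_tail: "B jk \<in> sets M \<and> measure M (B jk) \<le> sqrt 2 * exp (- u\<^sup>2 / 4)" if jkP: "jk \<in> P" for jk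
  proof -
    obtain j k where jk: "jk = (j, k)" and j: "-1 \<le> j" and k: "k \<in> I j"
      using jkP by (auto simp: P_def)
    let ?g = "\<psi> j k"
    have m: "?g \<in> borel_measurable borel" using psi[OF j k] by blast
    have i: "set_integrable lborel {0..1} (\<lambda>t. (?g t)\<^sup>2)"
      by (intro borel_integrable_atLeastAtMost' continuous_on_power psi_continuous[OF j k])
    have one: "(LINT t:{0..1}|lborel. (?g t)\<^sup>2) = 1"
      using orthonormal[OF j k j k] by (simp add: power2_eq_square)
    from W m i have "W ?g \<in> borel_measurable M \<and>
        (let s = sqrt (LINT t:{0..1}|lborel. (?g t)\<^sup>2) in
           if 0 < s then distributed M lborel (W ?g) (\<lambda>x. ennreal (normal_density 0 s x))
           else (AE \<omega> in M. W ?g \<omega> = 0))"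
      unfolding isonormal_def by blast
    then have meas[measurable]: "W ?g \<in> borel_measurable M"
      and d: "distributed M lborel (W ?g) (\<lambda>x. ennreal (normal_density 0 1 x))"
      by (auto simp: one)
    have "B jk \<in> sets M" unfolding B_def jk by simp
    then show ?thesis using std_normal_abs_tail[OF M d u] by (simp add: B_def jk)
  qed
  have "real (card P) \<le> 2 * c * real n"
  proof -
    have "real (card P) = (\<Sum>j\<in>{-1..int J}. real (card (I j)))"
      unfolding P_def using finite_index by (subst card_SigmaI) auto
    also have "\<dots> \<le> (\<Sum>j\<in>{-1..int J}. c * 2 powr (real_of_int j))"
      using index_card by (intro sum_mono) auto
    \<comment> \<open>Reindexing by \<open>j = i - 1\<close> brings the scaling level -1 in as
      \<open>2 ^ 0 / 2\<close>.\<close>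
    also have "\<dots> = (\<Sum>i<J + 2. c * (2 ^ i / 2))"
      by (rule sum.reindex_bij_witness[where i = "\<lambda>i. int i - 1" and j = "\<lambda>j. nat (j + 1)"])
        (auto simp: powr_realpow[symmetric] powr_diff powr_add nat_add_distrib)
    also have "\<dots> = c * (2 ^ (J + 2) - 1) / 2"
      by (simp only: sum_distrib_left[symmetric] sum_divide_distrib[symmetric] sum_gp_strict) (simp add: algebra_simps)
    also have "\<dots> \<le> c * (2 * 2 ^ J)" using c_pos by (simp add: algebra_simps)
    also have "\<dots> \<le> c * (2 * real n)" using J c_pos by (intro mult_left_mono) auto
    finally show ?thesis by simp
  qed
  then have cardP: "real (card P) * (sqrt 2 * exp (- u\<^sup>2 / 4)) \<le> 2 * c * real n * (sqrt 2 * exp (- u\<^sup>2 / 4))"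
    by (intro mult_right_mono) auto
  have A: "A = space M - (\<Union>jk\<in>P. B jk)"
    unfolding A_def B_def P_def by (force simp: not_less)
  have U: "(\<Union>jk\<in>P. B jk) \<in> sets M" using meas_tail finP by (intro sets.finite_UN) auto
  then show "A \<in> sets M" unfolding A by auto
  have "measure M (\<Union>jk\<in>P. B jk) \<le> (\<Sum>jk\<in>P. measure M (B jk))"
    using meas_tail finP by (intro finite_measure_subadditive_finite) auto
  also have "\<dots> \<le> (\<Sum>jk\<in>P. sqrt 2 * exp (- u\<^sup>2 / 4))" using meas_tail by (intro sum_mono) auto
  also have "\<dots> = real (card P) * (sqrt 2 * exp (- u\<^sup>2 / 4))" by simp
  also note cardP
  finally have "measure M (\<Union>jk\<in>P. B jk) \<le> 2 * c * real n * (sqrt 2 * exp (- u\<^sup>2 / 4))" .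
  then show "1 - 2 * c * real n * (sqrt 2 * exp (- u\<^sup>2 / 4)) \<le> measure M A"
    unfolding A using prob_compl[OF U] by simp
qed

text \<open>The constant \<open>c\<close> in the number of coefficients is arbitrary, so for the prescribed probability
  the noise level \<open>\<tau> / 2\<close> would be too small; \<open>3 \<tau> / 4\<close> leaves room for all large \<open>n\<close>, and the finitely
  many remaining \<open>n\<close> are handled by a constant noise bound.\<close>

lemma noise_level_exists:
  fixes c \<tau> :: real
  assumes "0 < \<tau>"
  shows "\<exists>N U. 0 \<le> U \<and> (\<forall>n\<ge>2. 2 * c * real n * (sqrt 2 * exp (- (if N \<le> n then 3 / 4 * \<tau> * sqrt (ln (real n)) else U)\<^sup>2 / 4))
     \<le> 3 * real n powr (-(\<tau>\<^sup>2 / 8 - 1)) / sqrt (2 * ln (real n)))"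
proof -
  \<comment> \<open>The surplus exponent: \<open>(3 / 4)\<^sup>2 / 4 = 9 / 64\<close> exceeds the
    required \<open>1 / 8\<close> by \<open>1 / 64\<close>. The resulting \<open>n powr - a\<close>
    beats the logarithm and the constant \<open>c\<close>.\<close>
  define a where "a = \<tau>\<^sup>2 / 64"
  have a: "0 < a" using assms by (simp add: a_def)
  have "((\<lambda>x::real. 2 * c * sqrt 2 * (sqrt (2 * ln x) * x powr - a)) \<longlongrightarrow> 0) at_top"
    using a by real_asymp
  then have "((\<lambda>n. 2 * c * sqrt 2 * (sqrt (2 * ln (real n)) * real n powr - a)) \<longlongrightarrow> 0) sequentially"
    by (rule filterlim_compose[OF _ filterlim_real_sequentially])
  then have "eventually (\<lambda>n. 2 * c * sqrt 2 * (sqrt (2 * ln (real n)) * real n powr - a) < 3) sequentially"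
    by (rule order_tendstoD) simp
  then obtain N where N: "\<And>n. N \<le> n \<Longrightarrow> 2 * c * sqrt 2 * (sqrt (2 * ln (real n)) * real n powr - a) < 3"
    unfolding eventually_sequentially by blast
  have large: "2 * c * real n * (sqrt 2 * exp (- (3 / 4 * \<tau> * sqrt (ln (real n)))\<^sup>2 / 4))
     \<le> 3 * real n powr (-(\<tau>\<^sup>2 / 8 - 1)) / sqrt (2 * ln (real n))" if n: "2 \<le> n" "N \<le> n" for n
  proof -
    have ln: "0 < ln (real n)" using n by simp
    let ?p = "real n powr (-(\<tau>\<^sup>2 / 8 - 1))"
    have "(3 / 4 * \<tau> * sqrt (ln (real n)))\<^sup>2 = 9 / 16 * \<tau>\<^sup>2 * ln (real n)"
      using ln by (simp add: power_mult_distrib power2_eq_square)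
    then have "exp (- (3 / 4 * \<tau> * sqrt (ln (real n)))\<^sup>2 / 4) = real n powr (- (9 / 64 * \<tau>\<^sup>2))"
      using n by (simp add: powr_def)
    moreover have "real n * real n powr (- (9 / 64 * \<tau>\<^sup>2)) = real n powr (1 + - (9 / 64 * \<tau>\<^sup>2))"
      using n by (subst powr_add) simp
    moreover have "1 + - (9 / 64 * \<tau>\<^sup>2) = -(\<tau>\<^sup>2 / 8 - 1) + - a" by (simp add: a_def)
    ultimately have "real n * exp (- (3 / 4 * \<tau> * sqrt (ln (real n)))\<^sup>2 / 4) = ?p * real n powr - a"
      by (simp only: powr_add)
    then have "2 * c * real n * (sqrt 2 * exp (- (3 / 4 * \<tau> * sqrt (ln (real n)))\<^sup>2 / 4)) = 2 * c * sqrt 2 * (?p * real n powr - a)"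
      by (metis mult.assoc mult.left_commute)
    moreover have "2 * c * sqrt 2 * (?p * real n powr - a) * sqrt (2 * ln (real n)) \<le> 3 * ?p"
    proof -
      have "?p * (2 * c * sqrt 2 * (sqrt (2 * ln (real n)) * real n powr - a)) \<le> ?p * 3"
        using N[OF n(2)] by (intro mult_left_mono) auto
      then show ?thesis by (simp only: mult_ac)
    qed
    moreover have "0 < sqrt (2 * ln (real n))" using ln by simp
    ultimately show ?thesis by (simp only: pos_le_divide_eq)
  qed
  \<comment> \<open>For each fixed \<open>n\<close> the target is positive while the tail tends to 0
    as \<open>u\<close> grows; finitely many \<open>n\<close> admit a common
    \<open>U\<close>.\<close>
  have "eventually (\<lambda>u. \<forall>n\<in>{2..<N}. 2 * c * real n * (sqrt 2 * exp (- u\<^sup>2 / 4))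
     \<le> 3 * real n powr (-(\<tau>\<^sup>2 / 8 - 1)) / sqrt (2 * ln (real n))) at_top"
  proof (rule eventually_ball_finite)
    show "\<forall>n\<in>{2..<N}. eventually (\<lambda>u. 2 * c * real n * (sqrt 2 * exp (- u\<^sup>2 / 4))
     \<le> 3 * real n powr (-(\<tau>\<^sup>2 / 8 - 1)) / sqrt (2 * ln (real n))) at_top"
    proof
      fix n assume "n \<in> {2..<N}"
      then have pos: "0 < 3 * real n powr (-(\<tau>\<^sup>2 / 8 - 1)) / sqrt (2 * ln (real n))" by simp
      have "((\<lambda>u::real. 2 * c * real n * (sqrt 2 * exp (- u\<^sup>2 / 4))) \<longlongrightarrow> 0) at_top" by real_asymp
      from order_tendstoD(2)[OF this pos]
      show "eventually (\<lambda>u. 2 * c * real n * (sqrt 2 * exp (- u\<^sup>2 / 4))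
        \<le> 3 * real n powr (-(\<tau>\<^sup>2 / 8 - 1)) / sqrt (2 * ln (real n))) at_top"
        by eventually_elim simp
    qed
  qed simp
  then have "eventually (\<lambda>u. 0 \<le> u \<and> (\<forall>n\<in>{2..<N}. 2 * c * real n * (sqrt 2 * exp (- u\<^sup>2 / 4))
     \<le> 3 * real n powr (-(\<tau>\<^sup>2 / 8 - 1)) / sqrt (2 * ln (real n)))) at_top"
    using eventually_ge_at_top[of 0] by (simp add: eventually_conj)
  then obtain U where U: "0 \<le> U" "\<And>n. n \<in> {2..<N} \<Longrightarrow> 2 * c * real n * (sqrt 2 * exp (- U\<^sup>2 / 4))
     \<le> 3 * real n powr (-(\<tau>\<^sup>2 / 8 - 1)) / sqrt (2 * ln (real n))"
    unfolding eventually_at_top_linorder by blast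
  show ?thesis
    by (rule exI[of _ N], rule exI[of _ U]) (use U large in auto)
qed

section \<open>Noise event and pathwise bound combined\<close>

text \<open>The probability is bounded below through a measurable event inside the good set, which
  avoids the question whether the supremum over all \<open>x\<close> is measurable. The event is
  that of bounded noise; everything after it is deterministic.\<close>

theorem theorem3p1:
  fixes S :: nat and \<psi> :: "int \<Rightarrow> int \<Rightarrow> real \<Rightarrow> real" and I :: "int \<Rightarrow> int set"
    and \<beta>1 \<beta>2 R1 R2 \<tau> :: real
    and M :: "'a measure" and W :: "(real \<Rightarrow> real) \<Rightarrow> 'a \<Rightarrow> real"
  assumes "0 < S" and "wavelet_basis S \<psi> I"
    and "0 < \<beta>1" and "\<beta>1 \<le> \<beta>2" and "\<beta>2 < real S"
    and "0 < R1" and "R1 \<le> R2"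
    and "2 * sqrt 2 < \<tau>"
    and "prob_space M" and "isonormal M W"
  shows "\<exists>C. \<forall>n::nat. \<forall>J::nat. \<forall>\<beta> R. \<forall>f :: real \<Rightarrow> real.
           2 \<le> n \<longrightarrow> real n / 2 \<le> 2 ^ J \<longrightarrow> 2 ^ J \<le> real n \<longrightarrow>
           \<beta>1 \<le> \<beta> \<longrightarrow> \<beta> \<le> \<beta>2 \<longrightarrow> R1 \<le> R \<longrightarrow> R \<le> R2 \<longrightarrow> H_ball \<beta> R f \<longrightarrow>
           (\<exists>A\<in>sets M.
              A \<subseteq> {\<omega>\<in>space M. \<forall>x\<in>{0..1}.
                     \<bar>fhat W \<psi> I \<tau> n J f \<omega> x - f x\<bar> / rtilde n \<beta> (f x) \<le> C} \<and>
              1 - 3 * real n powr (-(\<tau>\<^sup>2 / 8 - 1)) / sqrt (2 * ln (real n)) \<le> measure M A)"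
proof -
  obtain c where "wavelet_system S \<psi> I c" by (rule wavelet_basis_imp_system[OF assms(2)])
  then interpret wavelet_system S \<psi> I c .
  have \<tau>: "0 < \<tau>" using assms(8) real_sqrt_ge_zero[of 2] by linarith
  obtain N U where U: "0 \<le> U" and level: "\<And>n. 2 \<le> n \<Longrightarrow>
     2 * c * real n * (sqrt 2 * exp (- (if N \<le> n then 3 / 4 * \<tau> * sqrt (ln (real n)) else U)\<^sup>2 / 4))
     \<le> 3 * real n powr (-(\<tau>\<^sup>2 / 8 - 1)) / sqrt (2 * ln (real n))"
    using noise_level_exists[OF \<tau>, of c] by blast
  \<comment> \<open>\<open>6\<close> is twice the factor 3 of the thresholding lemma, as the true
    coefficient is \<open>2 * \<theta>\<close>; \<open>2 * \<tau>\<close> covers noise plus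
    threshold for large \<open>n\<close>, and \<open>2 * U + \<tau>\<close> does so for small
    \<open>n\<close>.\<close>
  define K1 where "K1 = 6 + 2 * \<tau> + 2 * U"
  have K1: "0 \<le> K1" "2 * \<tau> \<le> K1" "2 * U + \<tau> \<le> K1" "6 \<le> K1" using \<tau> U by (auto simp: K1_def)
  have N1: "1 \<le> 1 + real N" by simp
  obtain C where C: "\<And>n J \<beta> R f y x. 2 \<le> n \<Longrightarrow> real n / 2 \<le> 2 ^ J \<Longrightarrow> 2 ^ J \<le> real n \<Longrightarrow>
     \<beta>1 \<le> \<beta> \<Longrightarrow> \<beta> < real S \<Longrightarrow> R \<le> R2 \<Longrightarrow> H_ball \<beta> R f \<Longrightarrow>
     (\<forall>j\<in>{-1..int J}. \<forall>k\<in>I j.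
        \<bar>y j k - 2 * (LINT t:{0..1}|lborel. \<psi> j k t * sqrt (f t))\<bar> \<le> K1 * sqrt (ln (real n) / real n) \<and>
        (\<bar>y j k - 2 * (LINT t:{0..1}|lborel. \<psi> j k t * sqrt (f t))\<bar> \<le> K1 * \<bar>LINT t:{0..1}|lborel. \<psi> j k t * sqrt (f t)\<bar>
          \<or> real n \<le> 1 + real N)) \<Longrightarrow> x \<in> {0..1} \<Longrightarrow>
     \<bar>(\<Sum>j\<in>{-1..int J}. \<Sum>k\<in>I j. y j k * \<psi> j k x)\<^sup>2 / 4 - f x\<bar> \<le> C * rtilde n \<beta> (f x)"
    using coefficient_errors_imp_pathwise_rate[OF assms(3,1) K1(1) N1, of R2] by blast
  show ?thesis
  proof (intro exI[of _ C] allI impI)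
    fix n J :: nat and \<beta> R :: real and f :: "real \<Rightarrow> real"
    assume n: "2 \<le> n" "real n / 2 \<le> 2 ^ J" "2 ^ J \<le> real n" and \<beta>: "\<beta>1 \<le> \<beta>" "\<beta> \<le> \<beta>2"
      and R: "R1 \<le> R" "R \<le> R2" and H: "H_ball \<beta> R f"
    define u where "u = (if N \<le> n then 3 / 4 * \<tau> * sqrt (ln (real n)) else U)"
    have ln: "1 / 2 \<le> ln (real n)"
    proof -
      have "1 / 2 \<le> ln (2::real)" using ln2_ge_two_thirds by linarith
      also have "\<dots> \<le> ln (real n)" using n(1) by simp
      finally show ?thesis .
    qed
    have u0: "0 \<le> u" using U \<tau> n by (auto simp: u_def)
    define A where "A = {\<omega> \<in> space M. \<forall>j\<in>{-1..int J}. \<forall>k\<in>I j. \<bar>W (\<psi> j k) \<omega>\<bar> \<le> u}"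
    have A: "A \<in> sets M" "1 - 2 * c * real n * (sqrt 2 * exp (- u\<^sup>2 / 4)) \<le> measure M A"
      using noise_event[OF assms(9,10) u0 n(3)] unfolding A_def by blast+
    define \<delta> where "\<delta> = sqrt (ln (real n) / real n)"
    have \<delta>: "0 < \<delta>" using ln n by (simp add: \<delta>_def)
    have "\<bar>fhat W \<psi> I \<tau> n J f \<omega> x - f x\<bar> / rtilde n \<beta> (f x) \<le> C" if \<omega>: "\<omega> \<in> A" and x: "x \<in> {0..1}" for \<omega> x
    proof -
      define y where "y j k = Ycoef W \<psi> n f j k \<omega> *
        (if \<bar>Ycoef W \<psi> n f j k \<omega>\<bar> > \<tau> * sqrt (ln (real n) / real n) then 1 else 0)" for j k
      have "\<bar>(\<Sum>j\<in>{-1..int J}. \<Sum>k\<in>I j. y j k * \<psi> j k x)\<^sup>2 / 4 - f x\<bar> \<le> C * rtilde n \<beta> (f x)"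
      proof (rule C[OF n \<beta>(1) _ R(2) H _ x], goal_cases)
        case 1
        show ?case using \<beta>(2) assms(5) by linarith
      next
        case 2
        show ?case
        proof (intro ballI)
          fix j k assume j: "j \<in> {-1..int J}" and k: "k \<in> I j"
          define \<theta> where "\<theta> = (LINT t:{0..1}|lborel. \<psi> j k t * sqrt (f t))"
          define z where "z = W (\<psi> j k) \<omega> / sqrt (real n)"
          have zu: "\<bar>z\<bar> \<le> u / sqrt (real n)"
            using \<omega> j k by (auto simp: A_def z_def abs_divide intro!: divide_right_mono)
          have y: "y j k = (2 * \<theta> + z) * (if \<bar>2 * \<theta> + z\<bar> > \<tau> * \<delta> then 1 else 0)"
            by (simp add: y_def Ycoef_def \<theta>_def z_def \<delta>_def)
          have e1: "\<bar>y j k - 2 * \<theta>\<bar> \<le> \<bar>z\<bar> + \<tau> * \<delta>"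
            using thresholded_coefficient_error(1)[of "2 * \<theta>" z \<tau> \<delta>] \<tau> \<delta> unfolding y by simp
          have "\<bar>y j k - 2 * \<theta>\<bar> \<le> K1 * \<delta> \<and> (\<bar>y j k - 2 * \<theta>\<bar> \<le> K1 * \<bar>\<theta>\<bar> \<or> real n \<le> 1 + real N)"
          proof (cases "N \<le> n")
            case True
            have z: "\<bar>z\<bar> \<le> 3 / 4 * (\<tau> * \<delta>)" using zu True by (simp add: u_def \<delta>_def real_sqrt_divide)
            have "0 \<le> \<tau> * \<delta>" using \<tau> \<delta> by simp
            then have "\<bar>y j k - 2 * \<theta>\<bar> \<le> 2 * \<tau> * \<delta>" using e1 z by linarith
            also have "\<dots> \<le> K1 * \<delta>" using K1(2) \<delta> by (intro mult_right_mono) auto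
            finally have "\<bar>y j k - 2 * \<theta>\<bar> \<le> K1 * \<delta>" .
            moreover have "\<bar>y j k - 2 * \<theta>\<bar> \<le> 6 * \<bar>\<theta>\<bar>"
              using thresholded_coefficient_error(2)[OF z, of "2 * \<theta>"] unfolding y by (simp add: abs_mult)
            then have "\<bar>y j k - 2 * \<theta>\<bar> \<le> K1 * \<bar>\<theta>\<bar>" using mult_right_mono[OF K1(4), of "\<bar>\<theta>\<bar>"] by linarith
            ultimately show ?thesis by blast
          next
            case False
            have "\<bar>z\<bar> \<le> U * (1 / sqrt (real n))" using zu False by (simp add: u_def)
            \<comment> \<open>For small \<open>n\<close> the noise level carries no logarithm;
              \<open>ln n \<ge> 1 / 2\<close> restores it at the price of a factor 2.\<close>
            also have "1 / sqrt (real n) \<le> 2 * \<delta>"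
            proof -
              have "(1::real) \<le> 2 * sqrt (ln (real n))" using ln real_le_rsqrt[of "1 / 2" "ln (real n)"] by (simp add: power2_eq_square)
              then show ?thesis unfolding \<delta>_def real_sqrt_divide using n(1) by (simp add: divide_right_mono)
            qed
            finally have "\<bar>z\<bar> \<le> U * (2 * \<delta>)" using U by (simp add: mult_left_mono)
            then have "\<bar>y j k - 2 * \<theta>\<bar> \<le> (2 * U + \<tau>) * \<delta>" using e1 by (simp add: algebra_simps)
            also have "\<dots> \<le> K1 * \<delta>" using K1(3) \<delta> by (intro mult_right_mono) auto
            finally show ?thesis using False by simp
          qed
          then show "\<bar>y j k - 2 * (LINT t:{0..1}|lborel. \<psi> j k t * sqrt (f t))\<bar> \<le> K1 * sqrt (ln (real n) / real n) \<and>
            (\<bar>y j k - 2 * (LINT t:{0..1}|lborel. \<psi> j k t * sqrt (f t))\<bar> \<le> K1 * \<bar>LINT t:{0..1}|lborel. \<psi> j k t * sqrt (f t)\<bar>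
              \<or> real n \<le> 1 + real N)" unfolding \<theta>_def \<delta>_def .
        qed
      qed
      then have "\<bar>fhat W \<psi> I \<tau> n J f \<omega> x - f x\<bar> \<le> C * rtilde n \<beta> (f x)"
        unfolding fhat_def hhat_def y_def .
      moreover have "0 < rtilde n \<beta> (f x)" using n(1) by (auto simp: rtilde_def less_max_iff_disj)
      ultimately show ?thesis by (simp add: pos_divide_le_eq)
    qed
    then have "A \<subseteq> {\<omega>\<in>space M. \<forall>x\<in>{0..1}. \<bar>fhat W \<psi> I \<tau> n J f \<omega> x - f x\<bar> / rtilde n \<beta> (f x) \<le> C}"
      by (auto simp: A_def)
    moreover have "1 - 3 * real n powr (-(\<tau>\<^sup>2 / 8 - 1)) / sqrt (2 * ln (real n)) \<le> measure M A"
      using A(2) level[OF n(1)] unfolding u_def by linarith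
    ultimately show "\<exists>A\<in>sets M.
              A \<subseteq> {\<omega>\<in>space M. \<forall>x\<in>{0..1}.
                     \<bar>fhat W \<psi> I \<tau> n J f \<omega> x - f x\<bar> / rtilde n \<beta> (f x) \<le> C} \<and>
              1 - 3 * real n powr (-(\<tau>\<^sup>2 / 8 - 1)) / sqrt (2 * ln (real n)) \<le> measure M A"
      using A(1) by blast
  qed
qed

end
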